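(* Let $C=(C,\triangle_\prec,\triangle_\succ)$ be a dendriform coalgebra. If $H^3_{\mathrm{coDend}}(C,C)=0$, then every deformation of $C$ of finite order $n$ extends to a deformation of order $n+1$.
   Context: All vector spaces, linear maps and tensor products are over a field $\mathbb K$ of characteristic zero. A dendriform coalgebra $(C,\triangle_\prec,\triangle_\succ)$ is a vector space $C$ with linear maps $\triangle_\prec,\triangle_\succ:C\to C\otimes C$ satisfying $(\triangle_\prec\otimes\mathrm{id})\triangle_\prec=(\mathrm{id}\otimes(\triangle_\prec+\triangle_\succ))\triangle_\prec$, $(\triangle_\succ\otimes\mathrm{id})\triangle_\prec=(\mathrm{id}\otimes\triangle_\prec)\triangle_\succ$, $((\triangle_\prec+\triangle_\succ)\otimes\mathrm{id})\triangle_\succ=(\mathrm{id}\otimes\triangle_\succ)\triangle_\succ$. A deformation of order $n$ of $C$ is a pair $\triangle_{\prec,t}=\sum_{i=0}^n\triangle_{\prec,i}t^i$, $\triangle_{\succ,t}=\sum_{i=0}^n\triangle_{\succ,i}t^i$ with linear $\triangle_{\prec,i},\triangle_{\succ,i}:C\to C\otimes C$, $\triangle_{\prec,0}=\triangle_\prec$, $\triangle_{\succ,0}=\triangle_\succ$, satisfying the three dendriform coalgebra identities modulo $t^{n+1}$, i.e. for $k=0,\dots,n$: $\sum_{i+j=k}(\triangle_{\prec,i}\otimes\mathrm{id})\triangle_{\prec,j}=\sum_{i+j=k}(\mathrm{id}\otimes(\triangle_{\prec,i}+\triangle_{\succ,i}))\triangle_{\prec,j}$, $\sum_{i+j=k}(\triangle_{\succ,i}\otimes\mathrm{id})\triangle_{\prec,j}=\sum_{i+j=k}(\mathrm{id}\otimes\triangle_{\prec,i})\triangle_{\succ,j}$,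 $\sum_{i+j=k}((\triangle_{\prec,i}+\triangle_{\succ,i})\otimes\mathrm{id})\triangle_{\succ,j}=\sum_{i+j=k}(\mathrm{id}\otimes\triangle_{\succ,i})\triangle_{\succ,j}$. It extends to a deformation of order $n+1$ if there are linear maps $\triangle_{\prec,n+1},\triangle_{\succ,n+1}:C\to C\otimes C$ such that $(\triangle_{\prec,t}+\triangle_{\prec,n+1}t^{n+1},\ \triangle_{\succ,t}+\triangle_{\succ,n+1}t^{n+1})$ is a deformation of order $n+1$. Cohomology. $C_n=\{[1],\dots,[n]\}$ and $\mathbb K[C_n]$ is the vector space with basis $C_n$. For $m,n\ge1$, $1\le i\le m$ define $R_0^{m,i,n}:C_{m+n-1}\to C_m$ by $[r]\mapsto[r]$ if $r\le i-1$, $[r]\mapsto[i]$ if $i\le r\le i+n-1$, $[r]\mapsto[r-n+1]$ if $i+n\le r\le m+n-1$; and $R_1^{m,i,n}:C_{m+n-1}\to\mathbb K[C_n]$ by $[r]\mapsto[r-i+1]$ if $i\le r\le i+n-1$ and $[r]\mapsto[1]+\cdots+[n]$ otherwise. For $\sigma\in\mathrm{Hom}(\mathbb K[C_n]\otimes X,Y)$ and $x\in\mathbb K[C_n]$ write $\sigma_x=\sigma(x;-):X\to Y$ (linear in $x$). Put $\triangle_{[1]}=\triangle_\prec$, $\triangle_{[2]}=\triangle_\succ$, extended linearly to $\mathbb K[C_2]$. $H^\bullet_{\mathrm{coDend}}(C,C)$ is the cohomology of $C^0=0$, $C^n_{\mathrm{coDend}}(C,C)=\mathrm{Hom}(\mathbb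 K[C_n]\otimes C,C^{\otimes n})$ ($n\ge1$) with, for $[r]\in C_{n+1}$, $$(\delta_c\sigma)_{[r]}=(\mathrm{id}\otimes\sigma_{R_1^{2,2,n}[r]})\circ\triangle_{R_0^{2,2,n}[r]}+\sum_{i=1}^n(-1)^i(\mathrm{id}^{\otimes(i-1)}\otimes\triangle_{R_1^{n,i,2}[r]}\otimes\mathrm{id}^{\otimes(n-i)})\circ\sigma_{R_0^{n,i,2}[r]}+(-1)^{n+1}(\sigma_{R_1^{2,1,n}[r]}\otimes\mathrm{id})\circ\triangle_{R_0^{2,1,n}[r]}.$$ *)

theory Defs
  imports Complex_Main "HOL-Library.Function_Algebras"
begin

section \<open>Tensor powers of a vector space\<close>

text \<open>
  A vector space over the field \<open>'k\<close> is a type \<open>'c\<close> with a scalar multiplication \<open>scale\<close> satisfying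
  \<^locale>\<open>vector_space\<close>. The tensor power \<open>C\<^sup>\<otimes>\<^sup>n\<close> is realised without choosing a basis: the tensor
  \<open>v\<^sub>1 \<otimes> \<dots> \<otimes> v\<^sub>n\<close> is evaluation of \<open>n\<close>-linear forms at \<open>(v\<^sub>1, \<dots>, v\<^sub>n)\<close>, and \<open>C\<^sup>\<otimes>\<^sup>n\<close> is the span of
  these evaluations. The lemmas \<open>tensor_power_universal\<close> and \<open>tensor_power_unique\<close> below show that
  this has the universal property of the tensor power.
\<close>

type_synonym ('c, 'k) tensor = "('c list \<Rightarrow> 'k) \<Rightarrow> 'k"

definition tscale :: "'k::field \<Rightarrow> ('c, 'k) tensor \<Rightarrow> ('c, 'k) tensor" where
  "tscale a t = (\<lambda>\<phi>. a * t \<phi>)"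

definition multilinear ::
  "('k::field \<Rightarrow> 'c::ab_group_add \<Rightarrow> 'c) \<Rightarrow> ('k \<Rightarrow> 'w::ab_group_add \<Rightarrow> 'w) \<Rightarrow> nat
    \<Rightarrow> ('c list \<Rightarrow> 'w) \<Rightarrow> bool" where
  "multilinear scale scale' n f \<longleftrightarrow>
     (\<forall>vs i. length vs = n \<and> i < n \<longrightarrow> Vector_Spaces.linear scale scale' (\<lambda>v. f (vs[i := v])))"

text \<open>Only forms that are multilinear in \<open>length vs\<close> arguments matter; elsewhere the value is 0.\<close>

definition tensor :: "('k::field \<Rightarrow> 'c::ab_group_add \<Rightarrow> 'c) \<Rightarrow> 'c list \<Rightarrow> ('c, 'k) tensor" where
  "tensor scale vs = (\<lambda>\<phi>. if multilinear scale (*) (length vs) \<phi> then \<phi> vs else 0)"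

definition tensor_power :: "('k::field \<Rightarrow> 'c::ab_group_add \<Rightarrow> 'c) \<Rightarrow> nat \<Rightarrow> ('c, 'k) tensor set" where
  "tensor_power scale n = module.span tscale {tensor scale vs | vs. length vs = n}"

text \<open>The space \<open>Hom(C, C\<^sup>\<otimes>\<^sup>n)\<close>.\<close>

definition hom_tensor ::
  "('k::field \<Rightarrow> 'c::ab_group_add \<Rightarrow> 'c) \<Rightarrow> nat \<Rightarrow> ('c \<Rightarrow> ('c, 'k) tensor) set" where
  "hom_tensor scale n =
     {f. Vector_Spaces.linear scale tscale f \<and> range f \<subseteq> tensor_power scale n}"

text \<open>
  \<open>tensor_ids scale m i n f\<close> is \<open>id\<^sup>\<otimes>\<^sup>(\<^sup>i\<^sup>-\<^sup>1\<^sup>) \<otimes> f \<otimes> id\<^sup>\<otimes>\<^sup>(\<^sup>m\<^sup>-\<^sup>i\<^sup>) : C\<^sup>\<otimes>\<^sup>m \<rightarrow> C\<^sup>\<otimes>\<^sup>(\<^sup>m\<^sup>+\<^sup>n\<^sup>-\<^sup>1\<^sup>)\<close> for \<open>f : C \<rightarrow> C\<^sup>\<otimes>\<^sup>n\<close> and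
  \<open>1 \<le> i \<le> m\<close>; see \<open>tensor_ids_tensor\<close> for its values on \<open>v\<^sub>1 \<otimes> \<dots> \<otimes> v\<^sub>m\<close>, which together with
  \<open>tensor_ids_linear\<close> determine it on \<open>C\<^sup>\<otimes>\<^sup>m\<close>.
\<close>

definition tensor_ids ::
  "('k::field \<Rightarrow> 'c::ab_group_add \<Rightarrow> 'c) \<Rightarrow> nat \<Rightarrow> nat \<Rightarrow> nat \<Rightarrow> ('c \<Rightarrow> ('c, 'k) tensor)
    \<Rightarrow> ('c, 'k) tensor \<Rightarrow> ('c, 'k) tensor" where
  "tensor_ids scale m i n f t =
     (\<lambda>\<phi>. if multilinear scale (*) (m + n - 1) \<phi>
          then t (\<lambda>vs. f (vs ! (i - 1)) (\<lambda>ws. \<phi> (take (i - 1) vs @ ws @ drop i vs)))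
          else 0)"


subsection \<open>Justification of the model\<close>

lemma vector_space_tscale: "vector_space tscale"
  by unfold_locales (auto simp: tscale_def fun_eq_iff algebra_simps)

lemma vector_space_times: "vector_space ((*) :: 'k::field \<Rightarrow> 'k \<Rightarrow> 'k)"
  by unfold_locales (auto simp: algebra_simps)

lemma linear_iff':
  "Vector_Spaces.linear s1 s2 f \<longleftrightarrow>
     vector_space s1 \<and> vector_space s2 \<and> (\<forall>x y. f (x + y) = f x + f y) \<and> (\<forall>c x. f (s1 c x) = s2 c (f x))"
  unfolding module_hom_iff_linear [symmetric] module_hom_def module_hom_axioms_def
    module_iff_vector_space by auto

lemma linear_eval: "Vector_Spaces.linear tscale (*) (\<lambda>t. t \<phi>)"
  by (auto simp: linear_iff' vector_space_tscale vector_space_times tscale_def)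

theorem tensor_power_universal:
  fixes scale :: "'k::field \<Rightarrow> 'c::ab_group_add \<Rightarrow> 'c"
    and scale' :: "'k \<Rightarrow> 'w::ab_group_add \<Rightarrow> 'w"
  assumes W: "vector_space scale'" and f: "multilinear scale scale' n f"
  shows "\<exists>g. Vector_Spaces.linear tscale scale' g \<and>
             (\<forall>vs. length vs = n \<longrightarrow> g (tensor scale vs) = f vs)"
proof -
  interpret T: vector_space "tscale :: 'k \<Rightarrow> ('c,'k) tensor \<Rightarrow> _" by (rule vector_space_tscale)
  interpret W: vector_space scale' by (rule W)
  interpret K: vector_space "(*) :: 'k \<Rightarrow> 'k \<Rightarrow> 'k" by (rule vector_space_times)
  interpret TW: vector_space_pair "tscale :: 'k \<Rightarrow> ('c,'k) tensor \<Rightarrow> _" scale' ..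
  interpret WK: vector_space_pair scale' "(*) :: 'k \<Rightarrow> 'k \<Rightarrow> 'k" ..
  interpret TK: vector_space_pair "tscale :: 'k \<Rightarrow> ('c,'k) tensor \<Rightarrow> _" "(*) :: 'k \<Rightarrow> 'k \<Rightarrow> 'k" ..
  define P where "P = {tensor scale vs | vs. length vs = n}"
  obtain B where B: "B \<subseteq> P" "T.independent B" "P \<subseteq> T.span B"
    using T.maximal_independent_subset[of P] by blast
  have "\<forall>b\<in>B. \<exists>vs. length vs = n \<and> tensor scale vs = b" using B(1) by (auto simp: P_def)
  then obtain w where w: "\<And>b. b \<in> B \<Longrightarrow> length (w b) = n \<and> tensor scale (w b) = b" by metis
  define g where "g = TW.construct B (\<lambda>b. f (w b))"
  have lg: "Vector_Spaces.linear tscale scale' g"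
    unfolding g_def by (rule TW.linear_construct[OF B(2)])
  have "g (tensor scale vs) = f vs" if vs: "length vs = n" for vs
  proof (rule ccontr)
    define d where "d = g (tensor scale vs) - f vs"
    assume "g (tensor scale vs) \<noteq> f vs"
    then have "d \<noteq> 0" by (simp add: d_def)
    then have "W.independent {d}" by simp
    then obtain l where l: "Vector_Spaces.linear scale' (*) l" "l d = 1"
      using WK.linear_independent_extend[of "{d}" "\<lambda>_. 1"] by auto
    have m: "multilinear scale (*) n (\<lambda>xs. l (f xs))"
      using f l(1) unfolding multilinear_def linear_iff' by auto
    have lin: "Vector_Spaces.linear tscale (*) (\<lambda>t. l (g t))"
      using lg l(1) unfolding linear_iff' by auto
    have "l (g t) = t (\<lambda>xs. l (f xs))" if "t \<in> T.span B" for t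
    proof (rule TK.linear_eq_on[OF lin linear_eval that])
      fix b assume b: "b \<in> B"
      have "g b = f (w b)" unfolding g_def by (rule TW.construct_basis[OF B(2) b])
      moreover have "b (\<lambda>xs. l (f xs)) = l (f (w b))"
        using w[OF b] m by (metis (no_types, lifting) tensor_def)
      ultimately show "l (g b) = b (\<lambda>xs. l (f xs))" by simp
    qed
    moreover have "tensor scale vs \<in> T.span B" using B(3) vs by (auto simp: P_def)
    ultimately have "l (g (tensor scale vs)) = l (f vs)"
      using m vs by (simp add: tensor_def)
    then have "l d = 0"
      using l(1) unfolding d_def
      by (metis WK.linear_diff cancel_comm_monoid_add_class.diff_cancel)
    then show False using l(2) by simp
  qed
  then show ?thesis using lg by blast
qed

theorem tensor_power_unique:
  fixes scale :: "'k::field \<Rightarrow> 'c::ab_group_add \<Rightarrow> 'c"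
  assumes "Vector_Spaces.linear tscale scale' g" "Vector_Spaces.linear tscale scale' h"
    and "\<And>vs. length vs = n \<Longrightarrow> g (tensor scale vs) = h (tensor scale vs)"
    and "t \<in> tensor_power scale n"
  shows "g t = h t"
proof -
  interpret TW: vector_space_pair "tscale :: 'k \<Rightarrow> ('c,'k) tensor \<Rightarrow> _" scale'
    using assms(1) by (auto simp: vector_space_pair_def linear_iff')
  show ?thesis
    by (rule TW.linear_eq_on[OF assms(1,2) assms(4)[unfolded tensor_power_def]]) (use assms(3) in auto)
qed

theorem tensor_multilinear:
  fixes scale :: "'k::field \<Rightarrow> 'c::ab_group_add \<Rightarrow> 'c"
  assumes "vector_space scale"
  shows "multilinear scale tscale n (tensor scale)"
  unfolding multilinear_def linear_iff'
  by (auto simp: assms vector_space_tscale tensor_def tscale_def fun_eq_iff)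
     (auto simp: multilinear_def linear_iff')

theorem tensor_ids_linear:
  fixes scale :: "'k::field \<Rightarrow> 'c::ab_group_add \<Rightarrow> 'c"
  shows "Vector_Spaces.linear tscale tscale (tensor_ids scale m i n f)"
  by (auto simp: linear_iff' vector_space_tscale tensor_ids_def tscale_def fun_eq_iff)

lemma tensor_power_combine:
  fixes scale :: "'k::field \<Rightarrow> 'c::ab_group_add \<Rightarrow> 'c"
  assumes t: "t \<in> tensor_power scale n"
    and m: "multilinear scale (*) n \<phi>" "multilinear scale (*) n \<psi>"
    and eq: "\<And>vs. length vs = n \<Longrightarrow> \<chi> vs = a * \<phi> vs + b * \<psi> vs"
  shows "t \<chi> = a * t \<phi> + b * t \<psi>"
proof -
  have \<chi>: "multilinear scale (*) n \<chi>"
    using m by (auto simp: multilinear_def linear_iff' eq algebra_simps)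
  have l: "Vector_Spaces.linear tscale (*) (\<lambda>t. a * t \<phi> + b * t \<psi>)"
    by (auto simp: linear_iff' vector_space_tscale vector_space_times tscale_def algebra_simps)
  show ?thesis
    by (rule tensor_power_unique[OF linear_eval l _ t])
       (use m \<chi> eq in \<open>auto simp: tensor_def\<close>)
qed

text \<open>If \<open>f(v\<^sub>i) = \<Sum>\<^sub>w a\<^sub>w w\<^sub>1 \<otimes> \<dots> \<otimes> w\<^sub>n\<close> then \<open>v\<^sub>1 \<otimes> \<dots> \<otimes> v\<^sub>m\<close> is mapped to
  \<open>\<Sum>\<^sub>w a\<^sub>w v\<^sub>1 \<otimes> \<dots> \<otimes> v\<^sub>i\<^sub>-\<^sub>1 \<otimes> w\<^sub>1 \<otimes> \<dots> \<otimes> w\<^sub>n \<otimes> v\<^sub>i\<^sub>+\<^sub>1 \<otimes> \<dots> \<otimes> v\<^sub>m\<close>.\<close>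

theorem tensor_ids_tensor:
  fixes scale :: "'k::field \<Rightarrow> 'c::ab_group_add \<Rightarrow> 'c"
  assumes f: "f \<in> hom_tensor scale n" and i: "1 \<le> i" "i \<le> m" and vs: "length vs = m"
    and W: "finite W" "\<And>ws. ws \<in> W \<Longrightarrow> length ws = n"
    and fv: "f (vs ! (i - 1)) = (\<Sum>ws\<in>W. tscale (a ws) (tensor scale ws))"
  shows "tensor_ids scale m i n f (tensor scale vs) =
           (\<Sum>ws\<in>W. tscale (a ws) (tensor scale (take (i - 1) vs @ ws @ drop i vs)))"
proof (rule ext)
  fix \<phi> :: "'c list \<Rightarrow> 'k"
  have lf: "Vector_Spaces.linear scale tscale f" and rf: "\<And>c. f c \<in> tensor_power scale n"
    using f by (auto simp: hom_tensor_def)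
  have V: "vector_space scale" using lf by (simp add: linear_iff')
  have eval_sum: "(\<Sum>x\<in>W. g x) \<psi> = (\<Sum>x\<in>W. g x \<psi>)"
    for g :: "'c list \<Rightarrow> ('c,'k) tensor" and \<psi>
    using W(1) by (induction W rule: finite_induct) auto
  have len: "ws \<in> W \<Longrightarrow> length (take (i - 1) vs @ ws @ drop i vs) = m + n - 1" for ws
    using i vs W(2) by auto
  show "tensor_ids scale m i n f (tensor scale vs) \<phi> =
           (\<Sum>ws\<in>W. tscale (a ws) (tensor scale (take (i - 1) vs @ ws @ drop i vs))) \<phi>"
  proof (cases "multilinear scale (*) (m + n - 1) \<phi>")
    case False
    then show ?thesis using len by (simp add: eval_sum tensor_ids_def tscale_def tensor_def)
  next
    case True
    let ?\<psi> = "\<lambda>xs ws. \<phi> (take (i - 1) xs @ ws @ drop i xs)"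
    have upd: "\<phi> (us[j := x + y]) = \<phi> (us[j := x]) + \<phi> (us[j := y])"
      "\<phi> (us[j := scale c x]) = c * \<phi> (us[j := x])"
      if "length us = m + n - 1" "j < m + n - 1" for us j x y c
      using True that unfolding multilinear_def linear_iff' by blast+
    have in1: "multilinear scale (*) n (?\<psi> xs)" if "length xs = m" for xs
      unfolding multilinear_def linear_iff'
    proof (intro allI impI conjI, goal_cases)
      case (3 ws j x y)
      have "take (i - 1) xs @ ws[j := z] @ drop i xs =
            (take (i - 1) xs @ ws @ drop i xs)[i - 1 + j := z]" for z
        using 3 that i by (auto simp: list_update_append)
      then show ?case using 3 that i by simp (rule upd(1); auto)
    next
      case (4 ws j c x)
      have "take (i - 1) xs @ ws[j := z] @ drop i xs =
            (take (i - 1) xs @ ws @ drop i xs)[i - 1 + j := z]" for z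
        using 4 that i by (auto simp: list_update_append)
      then show ?case using 4 that i by simp (rule upd(2); auto)
    qed (simp_all add: V vector_space_times)
    have in2: "multilinear scale (*) m (\<lambda>xs. f (xs ! (i - 1)) (?\<psi> xs))"
      unfolding multilinear_def
    proof (intro allI impI, elim conjE)
      fix xs :: "'c list" and j assume xs: "length xs = m" and j: "j < m"
      show "Vector_Spaces.linear scale (*)
          (\<lambda>v. f (xs[j := v] ! (i - 1)) (?\<psi> (xs[j := v])))"
      proof (cases "j = i - 1")
        case True
        then have "(\<lambda>v. f (xs[j := v] ! (i - 1)) (?\<psi> (xs[j := v]))) = (\<lambda>v. f v (?\<psi> xs))"
          using xs j i by auto
        then show ?thesis
          using lf by (simp add: linear_iff' vector_space_times tscale_def)
      next
        case False
        define p where "p = (if j < i - 1 then j else j + n - 1)"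
        have p: "p < m + n - 1" using j i False by (auto simp: p_def)
        let ?c = "xs ! (i - 1)"
        have eq: "?\<psi> (xs[j := v]) ws = \<phi> ((take (i - 1) xs @ ws @ drop i xs)[p := v])"
          if ws: "length ws = n" for v ws
        proof (cases "j < i - 1")
          case True
          then show ?thesis
            using xs i by (simp add: p_def list_update_append take_update_swap)
        next
          case F: False
          then have "i \<le> j" using False by simp
          moreover have "j + n - 1 - (i - 1) - n = j - i" using \<open>i \<le> j\<close> i by simp
          ultimately show ?thesis
            using xs i ws F by (auto simp: p_def list_update_append drop_update_swap)
        qed
        have lin: "f ?c (?\<psi> (xs[j := z])) = a * f ?c (?\<psi> (xs[j := x])) + b * f ?c (?\<psi> (xs[j := y]))"
          if "\<And>us. length us = m + n - 1 \<Longrightarrow> \<phi> (us[p := z]) = a * \<phi> (us[p := x]) + b * \<phi> (us[p := y])"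
          for a b x y z
        proof (rule tensor_power_combine[OF rf in1 in1], goal_cases)
          case (3 ws)
          have "length (take (i - 1) xs @ ws @ drop i xs) = m + n - 1" using xs i 3 by simp
          then show ?case using that eq[OF 3] by simp
        qed (simp_all add: xs)
        have "f ?c (?\<psi> (xs[j := x + y])) = 1 * f ?c (?\<psi> (xs[j := x])) + 1 * f ?c (?\<psi> (xs[j := y]))" for x y
          by (rule lin) (use upd(1)[OF _ p] in simp)
        moreover have "f ?c (?\<psi> (xs[j := scale c x])) = c * f ?c (?\<psi> (xs[j := x])) + 0 * f ?c (?\<psi> (xs[j := x]))" for c x
          by (rule lin) (use upd(2)[OF _ p] in simp)
        ultimately show ?thesis
          using False xs j by (simp add: linear_iff' V vector_space_times)
      qed
    qed
    have "tensor_ids scale m i n f (tensor scale vs) \<phi> = f (vs ! (i - 1)) (?\<psi> vs)"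
      using True in2 vs by (simp add: tensor_ids_def tensor_def)
    also have "\<dots> = (\<Sum>ws\<in>W. a ws * \<phi> (take (i - 1) vs @ ws @ drop i vs))"
      unfolding fv using W(2) in1[OF vs] by (simp add: eval_sum tscale_def tensor_def)
    also have "\<dots> = (\<Sum>ws\<in>W. tscale (a ws) (tensor scale (take (i - 1) vs @ ws @ drop i vs))) \<phi>"
      using True len by (simp add: eval_sum tscale_def tensor_def)
    finally show ?thesis .
  qed
qed


section \<open>Dendriform coalgebras and their deformations\<close>

locale dendriform_coalgebra = vector_space scale
  for scale :: "'k::field_char_0 \<Rightarrow> 'c::ab_group_add \<Rightarrow> 'c" +
  fixes Dl Dr :: "'c \<Rightarrow> ('c, 'k) tensor"
  assumes Dl_hom: "Dl \<in> hom_tensor scale 2"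
    and Dr_hom: "Dr \<in> hom_tensor scale 2"
    and coDend1: "tensor_ids scale 2 1 2 Dl \<circ> Dl = tensor_ids scale 2 2 2 (Dl + Dr) \<circ> Dl"
    and coDend2: "tensor_ids scale 2 1 2 Dr \<circ> Dl = tensor_ids scale 2 2 2 Dl \<circ> Dr"
    and coDend3: "tensor_ids scale 2 1 2 (Dl + Dr) \<circ> Dr = tensor_ids scale 2 2 2 Dr \<circ> Dr"

text \<open>Only the coefficients \<open>L i\<close>, \<open>R i\<close> with \<open>i \<le> n\<close> of the families \<open>L\<close>, \<open>R\<close> belong to the
  deformation of order \<open>n\<close>; the remaining ones are irrelevant.\<close>

definition deformation ::
  "('k::field_char_0 \<Rightarrow> 'c::ab_group_add \<Rightarrow> 'c) \<Rightarrow> ('c \<Rightarrow> ('c, 'k) tensor) \<Rightarrow> ('c \<Rightarrow> ('c, 'k) tensor)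
    \<Rightarrow> nat \<Rightarrow> (nat \<Rightarrow> 'c \<Rightarrow> ('c, 'k) tensor) \<Rightarrow> (nat \<Rightarrow> 'c \<Rightarrow> ('c, 'k) tensor) \<Rightarrow> bool" where
  "deformation scale Dl Dr n L R \<longleftrightarrow>
     (\<forall>i\<le>n. L i \<in> hom_tensor scale 2 \<and> R i \<in> hom_tensor scale 2) \<and>
     L 0 = Dl \<and> R 0 = Dr \<and>
     (\<forall>k\<le>n.
        (\<Sum>(i, j)\<in>{(i, j). i + j = k}. tensor_ids scale 2 1 2 (L i) \<circ> L j) =
        (\<Sum>(i, j)\<in>{(i, j). i + j = k}. tensor_ids scale 2 2 2 (L i + R i) \<circ> L j) \<and>
        (\<Sum>(i, j)\<in>{(i, j). i + j = k}. tensor_ids scale 2 1 2 (R i) \<circ> L j) =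
        (\<Sum>(i, j)\<in>{(i, j). i + j = k}. tensor_ids scale 2 2 2 (L i) \<circ> R j) \<and>
        (\<Sum>(i, j)\<in>{(i, j). i + j = k}. tensor_ids scale 2 1 2 (L i + R i) \<circ> R j) =
        (\<Sum>(i, j)\<in>{(i, j). i + j = k}. tensor_ids scale 2 2 2 (R i) \<circ> R j))"

definition extends_to_next_order ::
  "('k::field_char_0 \<Rightarrow> 'c::ab_group_add \<Rightarrow> 'c) \<Rightarrow> ('c \<Rightarrow> ('c, 'k) tensor) \<Rightarrow> ('c \<Rightarrow> ('c, 'k) tensor)
    \<Rightarrow> nat \<Rightarrow> (nat \<Rightarrow> 'c \<Rightarrow> ('c, 'k) tensor) \<Rightarrow> (nat \<Rightarrow> 'c \<Rightarrow> ('c, 'k) tensor) \<Rightarrow> bool" where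
  "extends_to_next_order scale Dl Dr n L R \<longleftrightarrow>
     (\<exists>L' R'. L' \<in> hom_tensor scale 2 \<and> R' \<in> hom_tensor scale 2 \<and>
        deformation scale Dl Dr (n + 1) (L(n + 1 := L')) (R(n + 1 := R')))"


section \<open>The cohomology of a dendriform coalgebra\<close>

text \<open>The basis element \<open>[r]\<close> of \<open>\<bbbK>[C\<^sub>n]\<close> is the index \<open>r \<in> {1..n}\<close>, and an element of \<open>\<bbbK>[C\<^sub>n]\<close> is
  its coefficient function \<open>nat \<Rightarrow> 'k\<close>, of which only the values on \<open>{1..n}\<close> matter.\<close>

definition R0 :: "nat \<Rightarrow> nat \<Rightarrow> nat \<Rightarrow> nat \<Rightarrow> nat" where
  "R0 m i n r = (if r \<le> i - 1 then r else if r \<le> i + n - 1 then i else r - n + 1)"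

definition R1 :: "nat \<Rightarrow> nat \<Rightarrow> nat \<Rightarrow> nat \<Rightarrow> nat \<Rightarrow> 'k::field" where
  "R1 m i n r =
     (if i \<le> r \<and> r \<le> i + n - 1 then (\<lambda>s. if s = r - i + 1 then 1 else 0)
      else (\<lambda>s. if s \<in> {1..n} then 1 else 0))"

text \<open>A linear map \<open>\<sigma> : \<bbbK>[C\<^sub>n] \<otimes> C \<rightarrow> C\<^sup>\<otimes>\<^sup>n\<close> is given by the family of linear maps
  \<open>\<sigma> r = \<sigma>([r]; -) : C \<rightarrow> C\<^sup>\<otimes>\<^sup>n\<close> for \<open>r \<in> {1..n}\<close>, with \<open>\<sigma> r = 0\<close> for all other \<open>r\<close> so that equality of
  maps is equality of families. In particular \<open>cochains scale 0 = {0}\<close>.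
  \<open>at_vec n \<sigma> x\<close> is \<open>\<sigma>\<^sub>x = \<sigma>(x; -)\<close>.\<close>

definition cochains ::
  "('k::field_char_0 \<Rightarrow> 'c::ab_group_add \<Rightarrow> 'c) \<Rightarrow> nat \<Rightarrow> (nat \<Rightarrow> 'c \<Rightarrow> ('c, 'k) tensor) set" where
  "cochains scale n =
     {\<sigma>. (\<forall>r\<in>{1..n}. \<sigma> r \<in> hom_tensor scale n) \<and> (\<forall>r. r \<notin> {1..n} \<longrightarrow> \<sigma> r = 0)}"

definition at_vec ::
  "nat \<Rightarrow> (nat \<Rightarrow> 'c \<Rightarrow> ('c, 'k::field_char_0) tensor) \<Rightarrow> (nat \<Rightarrow> 'k) \<Rightarrow> 'c \<Rightarrow> ('c, 'k) tensor" where
  "at_vec n \<sigma> x = (\<lambda>c. \<Sum>s=1..n. tscale (x s) (\<sigma> s c))"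

definition costructure ::
  "('c \<Rightarrow> ('c, 'k::field_char_0) tensor) \<Rightarrow> ('c \<Rightarrow> ('c, 'k) tensor) \<Rightarrow> nat \<Rightarrow> 'c \<Rightarrow> ('c, 'k) tensor" where
  "costructure Dl Dr r = (if r = 1 then Dl else if r = 2 then Dr else 0)"

definition coboundary_map ::
  "('k::field_char_0 \<Rightarrow> 'c::ab_group_add \<Rightarrow> 'c) \<Rightarrow> ('c \<Rightarrow> ('c, 'k) tensor) \<Rightarrow> ('c \<Rightarrow> ('c, 'k) tensor)
    \<Rightarrow> nat \<Rightarrow> (nat \<Rightarrow> 'c \<Rightarrow> ('c, 'k) tensor) \<Rightarrow> (nat \<Rightarrow> 'c \<Rightarrow> ('c, 'k) tensor)" where
  "coboundary_map scale Dl Dr n \<sigma> = (\<lambda>r. if r \<in> {1..n+1} then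
     (\<lambda>c.
       tensor_ids scale 2 2 n (at_vec n \<sigma> (R1 2 2 n r)) (costructure Dl Dr (R0 2 2 n r) c)
       + (\<Sum>i=1..n. tscale ((-1) ^ i)
            (tensor_ids scale n i 2 (at_vec 2 (costructure Dl Dr) (R1 n i 2 r)) (\<sigma> (R0 n i 2 r) c)))
       + tscale ((-1) ^ (n + 1))
            (tensor_ids scale 2 1 n (at_vec n \<sigma> (R1 2 1 n r)) (costructure Dl Dr (R0 2 1 n r) c)))
     else 0)"

definition cocycles ::
  "('k::field_char_0 \<Rightarrow> 'c::ab_group_add \<Rightarrow> 'c) \<Rightarrow> ('c \<Rightarrow> ('c, 'k) tensor) \<Rightarrow> ('c \<Rightarrow> ('c, 'k) tensor)
    \<Rightarrow> nat \<Rightarrow> (nat \<Rightarrow> 'c \<Rightarrow> ('c, 'k) tensor) set" where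
  "cocycles scale Dl Dr n = {\<sigma> \<in> cochains scale n. coboundary_map scale Dl Dr n \<sigma> = 0}"

definition coboundaries ::
  "('k::field_char_0 \<Rightarrow> 'c::ab_group_add \<Rightarrow> 'c) \<Rightarrow> ('c \<Rightarrow> ('c, 'k) tensor) \<Rightarrow> ('c \<Rightarrow> ('c, 'k) tensor)
    \<Rightarrow> nat \<Rightarrow> (nat \<Rightarrow> 'c \<Rightarrow> ('c, 'k) tensor) set" where
  "coboundaries scale Dl Dr n =
     (if n = 0 then {0} else coboundary_map scale Dl Dr (n - 1) ` cochains scale (n - 1))"

text \<open>The elements of \<open>H\<^sup>n\<close> are the cosets \<open>\<sigma> + B\<^sup>n\<close> of the coboundaries \<open>B\<^sup>n\<close>, \<open>\<sigma>\<close> a cocycle; so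
  \<open>H\<^sup>n = 0\<close> means that \<open>B\<^sup>n\<close>, the zero coset, is the only element.\<close>

definition cohomology ::
  "('k::field_char_0 \<Rightarrow> 'c::ab_group_add \<Rightarrow> 'c) \<Rightarrow> ('c \<Rightarrow> ('c, 'k) tensor) \<Rightarrow> ('c \<Rightarrow> ('c, 'k) tensor)
    \<Rightarrow> nat \<Rightarrow> (nat \<Rightarrow> 'c \<Rightarrow> ('c, 'k) tensor) set set" where
  "cohomology scale Dl Dr n =
     (\<lambda>\<sigma>. {\<sigma> + \<beta> | \<beta>. \<beta> \<in> coboundaries scale Dl Dr n}) ` cocycles scale Dl Dr n"

end

theory Submission
  imports Defs
begin

text \<open>
  Write a pair \<open>(\<Delta>\<^sub>\<prec>, \<Delta>\<^sub>\<succ>)\<close> as one 2-cochain \<open>\<pi>\<close>, and let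
  \<open>\<sigma> \<bullet> \<tau> = \<sigma> \<circ>\<^sub>2 \<tau> - \<sigma> \<circ>\<^sub>1 \<tau>\<close>, where \<open>\<sigma> \<circ>\<^sub>i \<tau>\<close> applies \<open>\<sigma>\<close> to the \<open>i\<close>-th tensor factor
  of the values of \<open>\<tau>\<close>, the labels in \<open>C\<^sub>n\<close> being distributed by \<open>R0\<close> and \<open>R1\<close>. The three
  dendriform identities are the three components of \<open>\<pi> \<bullet> \<pi> = 0\<close>
  (\<open>circle_prod_costructure\<close>), and \<open>\<delta>\<sigma> = \<sigma> \<bullet> \<pi> + \<pi> \<bullet> \<sigma>\<close> for 2-cochains \<open>\<sigma>\<close>
  (\<open>coboundary_map_2\<close>). So a family \<open>p\<^sub>0 = \<pi>, p\<^sub>1, \<dots>, p\<^sub>n\<close> of 2-cochains is a deformation of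
  order \<open>n\<close> iff \<open>\<Theta>\<^sub>k = \<Sum>\<^bsub>i+j=k\<^esub> p\<^sub>i \<bullet> p\<^sub>j\<close> vanishes for \<open>k \<le> n\<close>. Set \<open>p\<^sub>n\<^sub>+\<^sub>1 = 0\<close> and compute
  \<open>\<Theta>\<^sub>n\<^sub>+\<^sub>1\<close> from it. A 2-cochain \<open>\<tau>\<close> extends the deformation iff \<open>\<Theta>\<^sub>n\<^sub>+\<^sub>1 + \<delta>\<tau> = 0\<close>. It is
  therefore enough that the obstruction \<open>\<Theta>\<^sub>n\<^sub>+\<^sub>1\<close> is a 3-cocycle: if \<open>H\<^sup>3 = 0\<close>, then it is some
  \<open>\<delta>\<sigma>\<close>, and \<open>\<tau> = -\<sigma>\<close> does the job.

  That \<open>\<Theta>\<^sub>n\<^sub>+\<^sub>1\<close> is a cocycle is a Bianchi identity. The differential of 3-cochains is linear in the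
  structure \<open>\<pi>\<close>, so it makes sense along any 2-cochain \<open>\<rho>\<close>; call it \<open>d\<^sub>\<rho>\<close>. Expanding
  \<open>d\<^sub>\<rho> (\<sigma> \<bullet> \<tau>)\<close> gives ten threefold compositions of \<open>\<rho>\<close>, \<open>\<sigma>\<close>, \<open>\<tau>\<close>, which by associativity of
  the partial compositions cancel in pairs up to permuting \<open>\<rho>\<close>, \<open>\<sigma>\<close>, \<open>\<tau>\<close>
  (\<open>coboundary_along_circle_prod\<close>). Summation over all \<open>i + j + k = N\<close> is invariant under these
  permutations, hence \<open>\<Sum>\<^bsub>i+l=N\<^esub> d\<^bsub>p\<^sub>i\<^esub> \<Theta>\<^sub>l = 0\<close> for every family \<open>p\<close> (\<open>Bianchi_identity\<close>). For
  \<open>N = n + 1\<close> the terms with \<open>l \<le> n\<close> vanish and \<open>d\<^sub>\<pi> \<Theta>\<^sub>n\<^sub>+\<^sub>1 = 0\<close> is left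
  (\<open>obstruction_closed\<close>).

  The associativity of partial composition is proved first for the maps \<open>id \<otimes> f \<otimes> id\<close>
  (\<open>tensor_ids_nested\<close>, \<open>tensor_ids_parallel\<close>), and then for labelled cochains
  (\<open>partial_comp_nested\<close>, \<open>partial_comp_parallel\<close>).
\<close>

section \<open>Maps on tensor powers\<close>

lemma linear_tscale_sum:
  assumes "Vector_Spaces.linear tscale tscale g"
  shows "g (\<Sum>x\<in>W. tscale (a x) (h x)) = (\<Sum>x\<in>W. tscale (a x) (g (h x)))"
proof -
  interpret Vector_Spaces.linear tscale tscale g by (rule assms)
  show ?thesis by (simp add: sum scale)
qed

lemma tensor_power_subspace:
  fixes scale :: "'k::field \<Rightarrow> 'c::ab_group_add \<Rightarrow> 'c"
  shows "module.subspace tscale (tensor_power scale n)"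
proof -
  interpret T: vector_space "tscale :: 'k::field \<Rightarrow> ('c,'k) tensor \<Rightarrow> _" by (rule vector_space_tscale)
  show ?thesis unfolding tensor_power_def by (rule T.subspace_span)
qed

lemma
  fixes scale :: "'k::field \<Rightarrow> 'c::ab_group_add \<Rightarrow> 'c"
  shows tensor_power_zero: "0 \<in> tensor_power scale n"
  and tensor_power_add:
    "\<lbrakk>s \<in> tensor_power scale n; t \<in> tensor_power scale n\<rbrakk> \<Longrightarrow> s + t \<in> tensor_power scale n"
  and tensor_power_scale: "t \<in> tensor_power scale n \<Longrightarrow> tscale a t \<in> tensor_power scale n"
proof -
  interpret T: vector_space "tscale :: 'k \<Rightarrow> ('c,'k) tensor \<Rightarrow> _" by (rule vector_space_tscale)
  note S = tensor_power_subspace[of scale n]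
  show "0 \<in> tensor_power scale n" by (rule T.subspace_0[OF S])
  show "\<lbrakk>s \<in> tensor_power scale n; t \<in> tensor_power scale n\<rbrakk> \<Longrightarrow> s + t \<in> tensor_power scale n"
    by (rule T.subspace_add[OF S])
  show "t \<in> tensor_power scale n \<Longrightarrow> tscale a t \<in> tensor_power scale n"
    by (rule T.subspace_scale[OF S])
qed

lemma tensor_in_tensor_power:
  fixes scale :: "'k::field \<Rightarrow> 'c::ab_group_add \<Rightarrow> 'c"
  shows "length vs = n \<Longrightarrow> tensor scale vs \<in> tensor_power scale n"
proof -
  interpret T: vector_space "tscale :: 'k \<Rightarrow> ('c,'k) tensor \<Rightarrow> _" by (rule vector_space_tscale)
  show "length vs = n \<Longrightarrow> ?thesis" unfolding tensor_power_def by (rule T.span_base) auto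
qed

text \<open>Indexing the sum by words instead of by tensors lets \<open>tensor_ids_tensor\<close> be applied to
  the value of any map in \<open>hom_tensor\<close>.\<close>

lemma tensor_power_sum_of_tensors:
  fixes scale :: "'k::field \<Rightarrow> 'c::ab_group_add \<Rightarrow> 'c"
  assumes "t \<in> tensor_power scale n"
  obtains W a where "finite W" "\<And>ws. ws \<in> W \<Longrightarrow> length ws = n"
    "t = (\<Sum>ws\<in>W. tscale (a ws) (tensor scale ws))"
proof -
  interpret T: vector_space "tscale :: 'k \<Rightarrow> ('c,'k) tensor \<Rightarrow> _" by (rule vector_space_tscale)
  obtain B r where B: "finite B" "B \<subseteq> {tensor scale vs | vs. length vs = n}"
    and t: "t = (\<Sum>b\<in>B. tscale (r b) b)"
    using assms unfolding tensor_power_def T.span_explicit by auto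
  have "\<forall>b\<in>B. \<exists>vs. length vs = n \<and> tensor scale vs = b" using B(2) by auto
  then obtain w where w: "\<And>b. b \<in> B \<Longrightarrow> length (w b) = n \<and> tensor scale (w b) = b" by metis
  have inj: "inj_on w B" by (rule inj_onI) (metis w)
  show thesis
  proof (rule that[of "w ` B" "\<lambda>ws. r (tensor scale ws)"])
    show "t = (\<Sum>ws\<in>w ` B. tscale (r (tensor scale ws)) (tensor scale ws))"
      unfolding t sum.reindex[OF inj] by (rule sum.cong) (simp_all add: w)
  qed (use B(1) w in auto)
qed

lemma tensor_power_map:
  fixes scale :: "'k::field \<Rightarrow> 'c::ab_group_add \<Rightarrow> 'c"
  assumes g: "Vector_Spaces.linear tscale tscale g"
    and gen: "\<And>vs. length vs = m \<Longrightarrow> g (tensor scale vs) \<in> tensor_power scale n"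
    and t: "t \<in> tensor_power scale m"
  shows "g t \<in> tensor_power scale n"
proof -
  interpret T: vector_space "tscale :: 'k \<Rightarrow> ('c,'k) tensor \<Rightarrow> _" by (rule vector_space_tscale)
  obtain W a where W: "\<And>ws. ws \<in> W \<Longrightarrow> length ws = m"
    and t: "t = (\<Sum>ws\<in>W. tscale (a ws) (tensor scale ws))"
    using tensor_power_sum_of_tensors[OF t] by metis
  show ?thesis unfolding t linear_tscale_sum[OF g]
    by (rule T.subspace_sum[OF tensor_power_subspace], rule tensor_power_scale, rule gen, rule W)
qed

text \<open>The map \<open>t \<mapsto> a\<^sub>1 \<otimes> \<dots> \<otimes> a\<^sub>k \<otimes> t \<otimes> b\<^sub>1 \<otimes> \<dots> \<otimes> b\<^sub>l\<close> on \<open>C\<^sup>\<otimes>\<^sup>n\<close>. It describes the values of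
  \<open>tensor_ids\<close> on pure tensors without choosing an expansion of \<open>f v\<close> into pure tensors, and its
  linearity reduces statements about those values to statements about concatenation of words.\<close>

definition frame ::
  "('k::field \<Rightarrow> 'c::ab_group_add \<Rightarrow> 'c) \<Rightarrow> 'c list \<Rightarrow> 'c list \<Rightarrow> nat
    \<Rightarrow> ('c, 'k) tensor \<Rightarrow> ('c, 'k) tensor" where
  "frame scale a b n t =
     (\<lambda>\<phi>. if multilinear scale (*) (length a + n + length b) \<phi> then t (\<lambda>ws. \<phi> (a @ ws @ b)) else 0)"

lemma frame_linear: "Vector_Spaces.linear tscale tscale (frame scale a b n)"
  by (auto simp: linear_iff' vector_space_tscale frame_def tscale_def fun_eq_iff)

lemma multilinear_frame:
  fixes scale :: "'k::field \<Rightarrow> 'c::ab_group_add \<Rightarrow> 'c"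
  assumes "multilinear scale scale' (length a + n + length b) \<phi>"
  shows "multilinear scale scale' n (\<lambda>ws. \<phi> (a @ ws @ b))"
  unfolding multilinear_def
proof (intro allI impI, elim conjE)
  fix ws :: "'c list" and i assume "length ws = n" "i < n"
  moreover from this have "a @ ws[i := v] @ b = (a @ ws @ b)[length a + i := v]" for v
    by (simp add: list_update_append)
  ultimately show "Vector_Spaces.linear scale scale' (\<lambda>v. \<phi> (a @ ws[i := v] @ b))"
    using assms unfolding multilinear_def by simp
qed

lemma frame_tensor: "length ws = n \<Longrightarrow> frame scale a b n (tensor scale ws) = tensor scale (a @ ws @ b)"
  by (auto simp: frame_def tensor_def fun_eq_iff multilinear_frame add.assoc)

lemma frame_in_tensor_power:
  fixes scale :: "'k::field \<Rightarrow> 'c::ab_group_add \<Rightarrow> 'c"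
  assumes "t \<in> tensor_power scale n" "length a + n + length b = m"
  shows "frame scale a b n t \<in> tensor_power scale m"
  by (rule tensor_power_map[OF frame_linear _ assms(1)])
     (use assms(2) in \<open>auto simp: frame_tensor intro!: tensor_in_tensor_power\<close>)

lemma linear_comp_tensor:
  assumes "Vector_Spaces.linear tscale tscale g" "Vector_Spaces.linear tscale tscale h"
  shows "Vector_Spaces.linear tscale tscale (\<lambda>t. g (h t))"
  using assms by (auto simp: linear_iff')

lemma linear_sum_tensor:
  fixes g :: "'i \<Rightarrow> ('c, 'k::field) tensor \<Rightarrow> ('c, 'k) tensor"
  assumes "\<And>x. x \<in> W \<Longrightarrow> Vector_Spaces.linear tscale tscale (g x)"
  shows "Vector_Spaces.linear tscale tscale (\<lambda>t. \<Sum>x\<in>W. tscale (a x) (g x t))"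
proof -
  interpret vector_space "tscale :: 'k \<Rightarrow> ('c,'k) tensor \<Rightarrow> _" by (rule vector_space_tscale)
  show ?thesis
    using assms
    by (auto simp: linear_iff' vector_space_tscale scale_right_distrib sum.distrib scale_sum_right
          mult.commute)
qed

lemma frame_frame:
  fixes scale :: "'k::field \<Rightarrow> 'c::ab_group_add \<Rightarrow> 'c"
  assumes "t \<in> tensor_power scale n"
  shows "frame scale a b (length c + n + length d) (frame scale c d n t) = frame scale (a @ c) (d @ b) n t"
  by (rule tensor_power_unique[OF linear_comp_tensor[OF frame_linear frame_linear] frame_linear _ assms])
     (simp add: frame_tensor)

lemma hom_tensor_value: "f \<in> hom_tensor scale n \<Longrightarrow> f c \<in> tensor_power scale n"
  by (auto simp: hom_tensor_def)

lemma tensor_ids_frame: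
  fixes scale :: "'k::field \<Rightarrow> 'c::ab_group_add \<Rightarrow> 'c"
  assumes f: "f \<in> hom_tensor scale n" and i: "length a + 1 = i" and m: "length a + 1 + length b = m"
  shows "tensor_ids scale m i n f (tensor scale (a @ v # b)) = frame scale a b n (f v)"
proof -
  obtain W \<alpha> where W: "finite W" "\<And>ws. ws \<in> W \<Longrightarrow> length ws = n"
    and fv: "f v = (\<Sum>ws\<in>W. tscale (\<alpha> ws) (tensor scale ws))"
    using tensor_power_sum_of_tensors[OF hom_tensor_value[OF f]] by metis
  have "tensor_ids scale m i n f (tensor scale (a @ v # b)) =
      (\<Sum>ws\<in>W. tscale (\<alpha> ws) (tensor scale (take (i - 1) (a @ v # b) @ ws @ drop i (a @ v # b))))"
    by (rule tensor_ids_tensor[OF f _ _ _ W]) (use i m fv in \<open>auto simp: nth_append\<close>)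
  also have "\<dots> = frame scale a b n (f v)"
    unfolding fv linear_tscale_sum[OF frame_linear]
    by (rule sum.cong) (use i W(2) in \<open>auto simp: frame_tensor\<close>)
  finally show ?thesis .
qed

lemma split_list_nth:
  assumes "1 \<le> i" "i \<le> length vs"
  obtains a v b where "vs = a @ v # b" "length a + 1 = i"
proof (rule that)
  show "vs = take (i - 1) vs @ vs ! (i - 1) # drop i vs"
    using id_take_nth_drop[of "i - 1" vs] assms by simp
qed (use assms in simp)

lemma tensor_ids_in_tensor_power:
  fixes scale :: "'k::field \<Rightarrow> 'c::ab_group_add \<Rightarrow> 'c"
  assumes f: "f \<in> hom_tensor scale n" and i: "1 \<le> i" "i \<le> m" and t: "t \<in> tensor_power scale m"
  shows "tensor_ids scale m i n f t \<in> tensor_power scale (m + n - 1)"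
proof (rule tensor_power_map[OF tensor_ids_linear _ t])
  fix vs :: "'c list" assume vs: "length vs = m"
  obtain a v b where s: "vs = a @ v # b" "length a + 1 = i" using split_list_nth i vs by metis
  show "tensor_ids scale m i n f (tensor scale vs) \<in> tensor_power scale (m + n - 1)"
    unfolding s(1)
    by (subst tensor_ids_frame[OF f s(2)], use s vs in simp, rule frame_in_tensor_power)
       (use hom_tensor_value[OF f] s vs in auto)
qed

lemma tensor_ids_comp_hom:
  fixes scale :: "'k::field \<Rightarrow> 'c::ab_group_add \<Rightarrow> 'c"
  assumes f: "f \<in> hom_tensor scale n" and g: "g \<in> hom_tensor scale p" and j: "1 \<le> j" "j \<le> n"
  shows "tensor_ids scale n j p g \<circ> f \<in> hom_tensor scale (n + p - 1)"
  using f tensor_ids_in_tensor_power[OF g j] tensor_ids_linear[of scale n j p g]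
  by (auto simp: hom_tensor_def linear_iff' image_subset_iff)

lemma hom_tensor_0:
  assumes "vector_space scale"
  shows "0 \<in> hom_tensor scale n"
  using assms by (auto simp: hom_tensor_def linear_iff' vector_space_tscale tensor_power_zero tscale_def fun_eq_iff)

lemma hom_tensor_add:
  fixes scale :: "'k::field \<Rightarrow> 'c::ab_group_add \<Rightarrow> 'c"
  assumes "f \<in> hom_tensor scale n" "g \<in> hom_tensor scale n"
  shows "f + g \<in> hom_tensor scale n"
  using assms
  by (auto simp: hom_tensor_def linear_iff' image_subset_iff tensor_power_add tscale_def fun_eq_iff
      algebra_simps)

lemma hom_tensor_uminus:
  fixes scale :: "'k::field \<Rightarrow> 'c::ab_group_add \<Rightarrow> 'c"
  assumes f: "f \<in> hom_tensor scale n"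
  shows "- f \<in> hom_tensor scale n"
proof -
  have e: "- t = tscale (- 1) t" for t :: "('c, 'k) tensor" by (simp add: tscale_def fun_eq_iff)
  have "- f c \<in> tensor_power scale n" for c
    unfolding e by (rule tensor_power_scale[OF hom_tensor_value[OF f]])
  then show ?thesis
    using f by (auto simp: hom_tensor_def linear_iff' image_subset_iff tscale_def fun_eq_iff)
qed

lemma hom_tensor_sum:
  assumes "vector_space scale" "\<And>x. x \<in> X \<Longrightarrow> f x \<in> hom_tensor scale n"
  shows "sum f X \<in> hom_tensor scale n"
  using assms(2) by (induction X rule: infinite_finite_induct)
    (auto simp: hom_tensor_0[OF assms(1)] hom_tensor_add)

lemma tensor_ids_add_hom:
  fixes scale :: "'k::field \<Rightarrow> 'c::ab_group_add \<Rightarrow> 'c"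
  assumes f: "f \<in> hom_tensor scale n" and g: "g \<in> hom_tensor scale n"
    and i: "1 \<le> i" "i \<le> m" and t: "t \<in> tensor_power scale m"
  shows "tensor_ids scale m i n (f + g) t = tensor_ids scale m i n f t + tensor_ids scale m i n g t"
proof (rule tensor_power_unique[OF tensor_ids_linear _ _ t])
  show "Vector_Spaces.linear tscale tscale
      (\<lambda>t. tensor_ids scale m i n f t + tensor_ids scale m i n g t)"
    using tensor_ids_linear[of scale m i n f] tensor_ids_linear[of scale m i n g]
    by (auto simp: linear_iff' vector_space.vector_space_assms[OF vector_space_tscale] fun_eq_iff)
  fix vs :: "'c list" assume vs: "length vs = m"
  obtain a v b where s: "vs = a @ v # b" "length a + 1 = i" using split_list_nth i vs by metis
  have m: "length a + 1 + length b = m" using s vs by simp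
  note fg = hom_tensor_add[OF f g]
  have "frame scale a b n (f v + g v) = frame scale a b n (f v) + frame scale a b n (g v)"
    using frame_linear[of scale a b n] by (auto simp: linear_iff')
  then show "tensor_ids scale m i n (f + g) (tensor scale vs) =
      tensor_ids scale m i n f (tensor scale vs) + tensor_ids scale m i n g (tensor scale vs)"
    unfolding s(1) tensor_ids_frame[OF f s(2) m] tensor_ids_frame[OF g s(2) m]
      tensor_ids_frame[OF fg s(2) m] by simp
qed

lemma tensor_ids_0_hom:
  assumes "vector_space scale" "1 \<le> i" "i \<le> m" "t \<in> tensor_power scale m"
  shows "tensor_ids scale m i n 0 t = 0"
  using tensor_ids_add_hom[OF hom_tensor_0[OF assms(1)] hom_tensor_0[OF assms(1)] assms(2-4)] by simp

lemma tensor_ids_sum_hom: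
  assumes "vector_space scale" "\<And>x. x \<in> X \<Longrightarrow> f x \<in> hom_tensor scale n"
    "1 \<le> i" "i \<le> m" "t \<in> tensor_power scale m"
  shows "tensor_ids scale m i n (\<Sum>x\<in>X. f x) t = (\<Sum>x\<in>X. tensor_ids scale m i n (f x) t)"
  using assms(2)
proof (induction X rule: infinite_finite_induct)
  case (insert x X)
  have "tensor_ids scale m i n (f x + (\<Sum>x\<in>X. f x)) t =
      tensor_ids scale m i n (f x) t + tensor_ids scale m i n (\<Sum>x\<in>X. f x) t"
    by (rule tensor_ids_add_hom) (use insert.prems assms in \<open>auto intro: hom_tensor_sum\<close>)
  then show ?case
    unfolding sum.insert[OF insert.hyps] using insert by (simp only: insert_iff) simp
qed (simp_all add: tensor_ids_0_hom[OF assms(1,3-5)])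

lemma tensor_ids_of_frame:
  fixes scale :: "'k::field \<Rightarrow> 'c::ab_group_add \<Rightarrow> 'c"
  assumes g: "g \<in> hom_tensor scale p" and j: "1 \<le> j" "j \<le> n" and t: "t \<in> tensor_power scale n"
  shows "tensor_ids scale (length a + n + length b) (length a + j) p g (frame scale a b n t) =
    frame scale a b (n + p - 1) (tensor_ids scale n j p g t)"
proof (rule tensor_power_unique[OF linear_comp_tensor[OF tensor_ids_linear frame_linear]
      linear_comp_tensor[OF frame_linear tensor_ids_linear] _ t])
  fix ws :: "'c list" assume ws: "length ws = n"
  obtain c v d where s: "ws = c @ v # d" "length c + 1 = j" using split_list_nth j ws by metis
  have "tensor_ids scale (length a + n + length b) (length a + j) p g (frame scale a b n (tensor scale ws))
      = tensor_ids scale (length a + n + length b) (length a + j) p g (tensor scale ((a @ c) @ v # (d @ b)))"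
    unfolding frame_tensor[OF ws] using s by simp
  also have "\<dots> = frame scale (a @ c) (d @ b) p (g v)"
    by (rule tensor_ids_frame[OF g]) (use s ws in auto)
  also have "\<dots> = frame scale a b (length c + p + length d) (frame scale c d p (g v))"
    by (rule frame_frame[symmetric, OF hom_tensor_value[OF g]])
  also have "frame scale c d p (g v) = tensor_ids scale n j p g (tensor scale ws)"
    unfolding s(1) by (rule tensor_ids_frame[symmetric, OF g]) (use s ws in auto)
  also have "length c + p + length d = n + p - 1" using s ws by auto
  finally show "tensor_ids scale (length a + n + length b) (length a + j) p g (frame scale a b n (tensor scale ws))
      = frame scale a b (n + p - 1) (tensor_ids scale n j p g (tensor scale ws))" .
qed

text \<open>Applying \<open>f\<close> in position \<open>i\<close> and then \<open>g\<close> inside the output of \<open>f\<close> is applying the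
  composite in position \<open>i\<close>: the factors outside position \<open>i\<close> are an inert frame for both.\<close>

lemma tensor_ids_nested:
  fixes scale :: "'k::field \<Rightarrow> 'c::ab_group_add \<Rightarrow> 'c"
  assumes f: "f \<in> hom_tensor scale n" and g: "g \<in> hom_tensor scale p"
    and i: "1 \<le> i" "i \<le> m" and j: "1 \<le> j" "j \<le> n" and t: "t \<in> tensor_power scale m"
  shows "tensor_ids scale (m + n - 1) (i + j - 1) p g (tensor_ids scale m i n f t) =
    tensor_ids scale m i (n + p - 1) (tensor_ids scale n j p g \<circ> f) t"
proof (rule tensor_power_unique[OF linear_comp_tensor[OF tensor_ids_linear tensor_ids_linear]
      tensor_ids_linear _ t])
  fix vs :: "'c list" assume vs: "length vs = m"
  obtain a v b where s: "vs = a @ v # b" "length a + 1 = i" using split_list_nth i vs by metis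
  have m: "length a + 1 + length b = m" using s vs by simp
  note gf = tensor_ids_comp_hom[OF f g j]
  have e: "m + n - 1 = length a + n + length b" "i + j - 1 = length a + j" using m s(2) by auto
  show "tensor_ids scale (m + n - 1) (i + j - 1) p g (tensor_ids scale m i n f (tensor scale vs)) =
    tensor_ids scale m i (n + p - 1) (tensor_ids scale n j p g \<circ> f) (tensor scale vs)"
    unfolding s(1) tensor_ids_frame[OF f s(2) m] tensor_ids_frame[OF gf s(2) m] e
    using tensor_ids_of_frame[OF g j hom_tensor_value[OF f], of a b] by simp
qed

text \<open>Maps acting on different factors commute; the position of \<open>f\<close> moves by \<open>n - 1\<close> when \<open>g\<close>,
  acting to its left, has replaced one factor by \<open>n\<close>.\<close>

lemma tensor_ids_parallel:
  fixes scale :: "'k::field \<Rightarrow> 'c::ab_group_add \<Rightarrow> 'c"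
  assumes f: "f \<in> hom_tensor scale p" and g: "g \<in> hom_tensor scale n"
    and i: "1 \<le> i" "i < k" "k \<le> m" and t: "t \<in> tensor_power scale m"
  shows "tensor_ids scale (m + p - 1) i n g (tensor_ids scale m k p f t) =
    tensor_ids scale (m + n - 1) (k + n - 1) p f (tensor_ids scale m i n g t)"
proof (rule tensor_power_unique[OF linear_comp_tensor[OF tensor_ids_linear tensor_ids_linear]
      linear_comp_tensor[OF tensor_ids_linear tensor_ids_linear] _ t])
  fix vs :: "'c list" assume vs: "length vs = m"
  obtain a v b' where s: "vs = a @ v # b'" "length a + 1 = i"
    using split_list_nth[of i vs] i vs by auto
  have kb: "1 \<le> k - i" "k - i \<le> length b'" using i vs s by auto
  obtain b w c where s': "b' = b @ w # c" "length b + 1 = k - i"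
    using split_list_nth[of "k - i" b'] kb by metis
  have vs': "vs = (a @ v # b) @ w # c" "vs = a @ v # (b @ w # c)" by (simp_all add: s s')
  have k: "length (a @ v # b) + 1 = k" and m: "length (a @ v # b) + 1 + length c = m"
    "length a + 1 + length (b @ w # c) = m"
    using s s' i vs by auto
  \<comment> \<open>Only \<open>g v\<close> is expanded into pure tensors; the resulting identity is linear in \<open>f w\<close>,
    which may then be replaced by a pure tensor.\<close>
  obtain W \<alpha> where W: "finite W" "\<And>ws. ws \<in> W \<Longrightarrow> length ws = n"
    and gv: "g v = (\<Sum>ws\<in>W. tscale (\<alpha> ws) (tensor scale ws))"
    using tensor_power_sum_of_tensors[OF hom_tensor_value[OF g]] by metis
  have "tensor_ids scale (m + n - 1) (k + n - 1) p f (tensor_ids scale m i n g (tensor scale vs)) =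
      tensor_ids scale (m + n - 1) (k + n - 1) p f (frame scale a (b @ w # c) n (g v))"
    unfolding vs'(2) tensor_ids_frame[OF g s(2) m(2)] ..
  also have "\<dots> = (\<Sum>ws\<in>W. tscale (\<alpha> ws)
      (tensor_ids scale (m + n - 1) (k + n - 1) p f (tensor scale ((a @ ws @ b) @ w # c))))"
    unfolding gv linear_tscale_sum[OF linear_comp_tensor[OF tensor_ids_linear frame_linear]]
    by (rule sum.cong) (simp_all add: frame_tensor W(2))
  also have "\<dots> = (\<Sum>ws\<in>W. tscale (\<alpha> ws) (frame scale (a @ ws @ b) c p (f w)))"
    by (rule sum.cong, simp, subst tensor_ids_frame[OF f]) (use k m W(2) in auto)
  also have "\<dots> = tensor_ids scale (m + p - 1) i n g (frame scale (a @ v # b) c p (f w))"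
  proof (rule tensor_power_unique[symmetric, OF linear_comp_tensor[OF tensor_ids_linear frame_linear]
        linear_sum_tensor[OF frame_linear] _ hom_tensor_value[OF f]])
    fix us :: "'c list" assume us: "length us = p"
    have "tensor_ids scale (m + p - 1) i n g (frame scale (a @ v # b) c p (tensor scale us)) =
        tensor_ids scale (m + p - 1) i n g (tensor scale (a @ v # (b @ us @ c)))"
      by (simp add: frame_tensor us)
    also have "\<dots> = frame scale a (b @ us @ c) n (g v)"
      by (rule tensor_ids_frame[OF g s(2)]) (use m us in auto)
    also have "\<dots> = (\<Sum>ws\<in>W. tscale (\<alpha> ws) (tensor scale (a @ ws @ b @ us @ c)))"
      unfolding gv linear_tscale_sum[OF frame_linear] by (rule sum.cong) (simp_all add: frame_tensor W(2))
    also have "\<dots> = (\<Sum>ws\<in>W. tscale (\<alpha> ws) (frame scale (a @ ws @ b) c p (tensor scale us)))"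
      by (simp add: frame_tensor us)
    finally show "tensor_ids scale (m + p - 1) i n g (frame scale (a @ v # b) c p (tensor scale us)) = \<dots>" .
  qed
  also have "\<dots> = tensor_ids scale (m + p - 1) i n g (tensor_ids scale m k p f (tensor scale vs))"
    unfolding vs'(1) tensor_ids_frame[OF f k m(1)] ..
  finally show "tensor_ids scale (m + p - 1) i n g (tensor_ids scale m k p f (tensor scale vs)) =
    tensor_ids scale (m + n - 1) (k + n - 1) p f (tensor_ids scale m i n g (tensor scale vs))" ..
qed

section \<open>Partial composition of cochains\<close>

text \<open>The operation \<open>\<sigma> \<circ>\<^sub>i \<tau>\<close> on cochains, which performs \<open>\<tau>\<close> first. Up to sign, all summands of
  the coboundary map have this form. Outside \<open>{1..m + n - 1}\<close> it vanishes, so that composites of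
  cochains are cochains.\<close>

definition partial_comp ::
  "('k::field_char_0 \<Rightarrow> 'c::ab_group_add \<Rightarrow> 'c) \<Rightarrow> nat \<Rightarrow> nat \<Rightarrow> nat
    \<Rightarrow> (nat \<Rightarrow> 'c \<Rightarrow> ('c, 'k) tensor) \<Rightarrow> (nat \<Rightarrow> 'c \<Rightarrow> ('c, 'k) tensor) \<Rightarrow> (nat \<Rightarrow> 'c \<Rightarrow> ('c, 'k) tensor)"
  where
  "partial_comp scale m i n \<sigma> \<tau> = (\<lambda>r. if r \<in> {1..m + n - 1}
     then tensor_ids scale m i n (at_vec n \<sigma> (R1 m i n r)) \<circ> \<tau> (R0 m i n r) else 0)"

lemma sum_fun_apply:
  fixes f :: "'i \<Rightarrow> 'a \<Rightarrow> 'b::comm_monoid_add"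
  shows "(\<Sum>x\<in>X. f x) c = (\<Sum>x\<in>X. f x c)"
  by (induction X rule: infinite_finite_induct) auto

lemma at_vec_R1:
  fixes \<sigma> :: "nat \<Rightarrow> 'c \<Rightarrow> ('c, 'k::field_char_0) tensor"
  assumes "1 \<le> i"
  shows "at_vec n \<sigma> (R1 m i n r) =
    (if i \<le> r \<and> r \<le> i + n - 1 then \<sigma> (r - i + 1) else (\<Sum>s=1..n. \<sigma> s))"
proof -
  interpret T: vector_space "tscale :: 'k \<Rightarrow> ('c,'k) tensor \<Rightarrow> _" by (rule vector_space_tscale)
  have "(\<Sum>s=1..n. tscale (if s = r - i + 1 then 1 else 0) (\<sigma> s c)) =
      (\<Sum>s=1..n. if s = r - i + 1 then \<sigma> s c else 0)" for c
    by (rule sum.cong) auto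
  moreover have "(\<Sum>s=1..n. tscale (if s \<in> {1..n} then 1 else 0) (\<sigma> s c)) = (\<Sum>s=1..n. \<sigma> s c)" for c
    by (rule sum.cong) auto
  ultimately show ?thesis
    using assms by (auto simp: at_vec_def R1_def intro!: ext) (simp_all add: sum_fun_apply)
qed

lemma cochains_hom: "\<lbrakk>\<sigma> \<in> cochains scale n; 1 \<le> r; r \<le> n\<rbrakk> \<Longrightarrow> \<sigma> r \<in> hom_tensor scale n"
  by (auto simp: cochains_def)

lemma at_vec_R1_hom:
  assumes "vector_space scale" "\<sigma> \<in> cochains scale n" "1 \<le> i"
  shows "at_vec n \<sigma> (R1 m i n r) \<in> hom_tensor scale n"
  unfolding at_vec_R1[OF assms(3)]
  using assms by (auto intro!: hom_tensor_sum cochains_hom)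

lemma R0_range:
  assumes "1 \<le> i" "i \<le> m" "1 \<le> r" "r \<le> m + n - 1"
  shows "1 \<le> R0 m i n r" "R0 m i n r \<le> m"
  using assms by (auto simp: R0_def)

lemma partial_comp_cochain:
  assumes "vector_space scale" "\<sigma> \<in> cochains scale n" "\<tau> \<in> cochains scale m" "1 \<le> i" "i \<le> m"
  shows "partial_comp scale m i n \<sigma> \<tau> \<in> cochains scale (m + n - 1)"
proof -
  have "tensor_ids scale m i n (at_vec n \<sigma> (R1 m i n r)) \<circ> \<tau> (R0 m i n r) \<in> hom_tensor scale (m + n - 1)"
    if "1 \<le> r" "r \<le> m + n - 1" for r
    using tensor_ids_comp_hom[OF cochains_hom[OF assms(3)] at_vec_R1_hom[OF assms(1,2,4)] assms(4,5)]
      R0_range[OF assms(4,5) that] by blast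
  then show ?thesis by (auto simp: cochains_def partial_comp_def)
qed

text \<open>The labels \<open>1, \<dots>, n + p - 1\<close> arise from \<open>1, \<dots>, n\<close> by replacing \<open>j\<close> with a block of
  length \<open>p\<close>. This is how \<open>R0 n j p\<close> and \<open>R1 n j p\<close> read them.\<close>

lemma sum_inserted_block:
  fixes h :: "nat \<Rightarrow> 'a::comm_monoid_add"
  assumes "1 \<le> j" "j \<le> n" "1 \<le> p"
  shows "(\<Sum>s=1..n + p - 1. h s) =
    (\<Sum>s\<in>{1..n} - {j}. h (if s < j then s else s + p - 1)) + (\<Sum>q=1..p. h (j - 1 + q))"
proof -
  let ?g = "\<lambda>s. if s < j then s else s + p - 1"
  have i1: "inj_on ?g ({1..n} - {j})" using assms by (auto simp: inj_on_def split: if_splits)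
  have i2: "inj_on (\<lambda>q. j - 1 + q) {1..p}" by (auto simp: inj_on_def)
  have im2: "(\<lambda>q. j - 1 + q) ` {1..p} = {j..j + p - 1}"
    using assms image_add_atLeastAtMost[of "j - 1" 1 p] by (simp add: add.commute)
  have im1: "?g ` ({1..n} - {j}) = {1..n + p - 1} - {j..j + p - 1}"
  proof (intro equalityI subsetI)
    fix x assume x: "x \<in> {1..n + p - 1} - {j..j + p - 1}"
    show "x \<in> ?g ` ({1..n} - {j})"
      by (rule image_eqI[of _ _ "if x < j then x else x - (p - 1)"]) (use x assms in auto)
  qed (use assms in \<open>auto split: if_splits\<close>)
  have "(\<Sum>s=1..n + p - 1. h s) = sum h ({1..n + p - 1} - {j..j + p - 1}) + sum h {j..j + p - 1}"
    by (rule sum.subset_diff) (use assms in auto)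
  also have "sum h ({1..n + p - 1} - {j..j + p - 1}) = (\<Sum>s\<in>{1..n} - {j}. h (?g s))"
    unfolding im1[symmetric] sum.reindex[OF i1] by simp
  also have "sum h {j..j + p - 1} = (\<Sum>q=1..p. h (j - 1 + q))"
    unfolding im2[symmetric] sum.reindex[OF i2] by simp
  finally show ?thesis .
qed

text \<open>The value of a composite at \<open>[1] + \<dots> + [n + p - 1]\<close>. A label outside the block feeds
  \<open>[1] + \<dots> + [p]\<close> into \<open>\<rho>\<close> directly, and the labels in the block do so together, since they run
  through \<open>[1], \<dots>, [p]\<close>.\<close>

lemma sum_partial_comp:
  assumes V: "vector_space scale" and \<rho>: "\<rho> \<in> cochains scale p" and \<sigma>: "\<sigma> \<in> cochains scale n"
    and j: "1 \<le> j" "j \<le> n" and p: "1 \<le> p"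
  shows "(\<Sum>s=1..n + p - 1. partial_comp scale n j p \<rho> \<sigma> s) =
    tensor_ids scale n j p (\<Sum>q=1..p. \<rho> q) \<circ> (\<Sum>s=1..n. \<sigma> s)"
proof
  fix c
  let ?P = "tensor_ids scale n j p"
  interpret P: Vector_Spaces.linear tscale tscale "?P f" for f by (rule tensor_ids_linear)
  have "(\<Sum>s=1..n + p - 1. partial_comp scale n j p \<rho> \<sigma> s c) =
      (\<Sum>s\<in>{1..n} - {j}. partial_comp scale n j p \<rho> \<sigma> (if s < j then s else s + p - 1) c) +
      (\<Sum>q=1..p. partial_comp scale n j p \<rho> \<sigma> (j - 1 + q) c)"
    by (rule sum_inserted_block[OF j p])
  also have "(\<Sum>s\<in>{1..n} - {j}. partial_comp scale n j p \<rho> \<sigma> (if s < j then s else s + p - 1) c) =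
      (\<Sum>s\<in>{1..n} - {j}. ?P (\<Sum>q=1..p. \<rho> q) (\<sigma> s c))"
    by (rule sum.cong) (use j p in \<open>auto simp: partial_comp_def at_vec_R1 R0_def\<close>)
  also have "(\<Sum>q=1..p. partial_comp scale n j p \<rho> \<sigma> (j - 1 + q) c) = (\<Sum>q=1..p. ?P (\<rho> q) (\<sigma> j c))"
    by (rule sum.cong) (use j p in \<open>auto simp: partial_comp_def at_vec_R1 R0_def\<close>)
  also have "\<dots> = ?P (\<Sum>q=1..p. \<rho> q) (\<sigma> j c)"
    by (rule tensor_ids_sum_hom[symmetric, OF V _ j hom_tensor_value[OF cochains_hom[OF \<sigma> j]]])
       (use \<rho> in \<open>auto intro: cochains_hom\<close>)
  also have "(\<Sum>s\<in>{1..n} - {j}. ?P (\<Sum>q=1..p. \<rho> q) (\<sigma> s c)) + \<dots> =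
      (\<Sum>s=1..n. ?P (\<Sum>q=1..p. \<rho> q) (\<sigma> s c))"
    using sum.remove[of "{1..n}" j "\<lambda>s. ?P (\<Sum>q=1..p. \<rho> q) (\<sigma> s c)"] j by (simp add: add.commute)
  also have "\<dots> = (?P (\<Sum>q=1..p. \<rho> q) \<circ> (\<Sum>s=1..n. \<sigma> s)) c"
    by (simp only: P.sum sum_fun_apply comp_apply)
  finally show "(\<Sum>s=1..n + p - 1. partial_comp scale n j p \<rho> \<sigma> s) c =
    (?P (\<Sum>q=1..p. \<rho> q) \<circ> (\<Sum>s=1..n. \<sigma> s)) c"
    by (subst sum_fun_apply)
qed

text \<open>The maps \<open>R0\<close> and \<open>R1\<close> are associative: refining a label in one step or in two gives the
  same arguments for \<open>\<rho>\<close> and \<open>\<sigma>\<close>. A label outside the block of \<open>\<sigma>\<close> supplies the sum of all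
  basis elements to both, which is the case of \<open>sum_partial_comp\<close>.\<close>

lemma at_vec_partial_comp:
  assumes V: "vector_space scale" and \<rho>: "\<rho> \<in> cochains scale p" and \<sigma>: "\<sigma> \<in> cochains scale n"
    and i: "1 \<le> i" and j: "1 \<le> j" "j \<le> n" and p: "1 \<le> p" and r: "1 \<le> r"
  shows "at_vec (n + p - 1) (partial_comp scale n j p \<rho> \<sigma>) (R1 m i (n + p - 1) r) =
    tensor_ids scale n j p (at_vec p \<rho> (R1 (m + n - 1) (i + j - 1) p r)) \<circ>
    at_vec n \<sigma> (R1 m i n (R0 (m + n - 1) (i + j - 1) p r))"
proof -
  have ij: "1 \<le> i + j - 1" using i j by simp
  show ?thesis
  proof (cases "i \<le> r \<and> r \<le> i + (n + p - 1) - 1")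
    case True
    then obtain s where s: "r = i - 1 + s" "1 \<le> s" "s \<le> n + p - 1"
      using that[of "r - i + 1"] i by auto
    have rs: "r - i + 1 = s" using s i by simp
    have block: "i + j - 1 \<le> r \<and> r \<le> i + j - 1 + p - 1 \<longleftrightarrow> j \<le> s \<and> s \<le> j + p - 1"
      using s(1) i j by auto
    have R: "R0 (m + n - 1) (i + j - 1) p r = i - 1 + R0 n j p s"
      using s i j p by (simp add: R0_def) linarith
    have inner: "i \<le> i - 1 + R0 n j p s \<and> i - 1 + R0 n j p s \<le> i + n - 1"
      "i - 1 + R0 n j p s - i + 1 = R0 n j p s"
      using R0_range[OF j s(2,3)] i by auto
    have "at_vec p \<rho> (R1 (m + n - 1) (i + j - 1) p r) = at_vec p \<rho> (R1 n j p s)"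
      unfolding at_vec_R1[OF ij] at_vec_R1[OF j(1)] block using s(1) i j by simp
    then show ?thesis
      unfolding at_vec_R1[OF i] if_P[OF True] rs R if_P[OF inner(1)] inner(2)
      using s by (simp add: partial_comp_def)
  next
    case False
    have e: "\<not> (i + j - 1 \<le> r \<and> r \<le> i + j - 1 + p - 1)"
      "\<not> (i \<le> R0 (m + n - 1) (i + j - 1) p r \<and> R0 (m + n - 1) (i + j - 1) p r \<le> i + n - 1)"
      using False i j p by (auto simp: R0_def)
    show ?thesis
      unfolding at_vec_R1[OF i] at_vec_R1[OF ij] if_not_P[OF False] if_not_P[OF e(1)] if_not_P[OF e(2)]
      by (rule sum_partial_comp[OF V \<rho> \<sigma> j p])
  qed
qed

lemma R0_Suc: "R0 m (Suc i) (Suc n) r = (if r \<le> i then r else if r \<le> i + n + 1 then Suc i else r - n)"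
  by (auto simp: R0_def)

lemma R0_nested:
  assumes "1 \<le> i" "1 \<le> j" "j \<le> n" "1 \<le> p"
  shows "R0 m i n (R0 (m + n - 1) (i + j - 1) p r) = R0 m i (n + p - 1) r"
proof -
  obtain i' j' n' p' where e: "i = Suc i'" "j = Suc j'" "n = Suc n'" "p = Suc p'"
    using assms by (metis Suc_le_D One_nat_def)
  consider "r \<le> i' + j'" | "i' + j' < r" "r \<le> i' + j' + p' + 1" | "i' + j' + p' + 1 < r"
    by linarith
  then show ?thesis using assms(3) unfolding e by cases (simp_all add: R0_Suc, linarith?)
qed

lemma R0_parallel:
  assumes "1 \<le> i" "i < k" "1 \<le> n" "1 \<le> p"
  shows "R0 m k p (R0 (m + p - 1) i n r) = R0 m i n (R0 (m + n - 1) (k + n - 1) p r)"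
proof -
  obtain i' k' n' p' where e: "i = Suc i'" "k = Suc k'" "n = Suc n'" "p = Suc p'"
    using assms by (metis Suc_le_D One_nat_def less_imp_le_nat)
  consider "r \<le> i'" | "i' < r" "r \<le> i' + n' + 1" | "i' + n' + 1 < r" "r \<le> k' + n'"
    | "k' + n' < r" "r \<le> k' + n' + p' + 1" | "k' + n' + p' + 1 < r" by linarith
  then show ?thesis
    using assms(2) unfolding e by cases (simp_all add: R0_Suc add.commute[of n' p'], linarith?)
qed

lemma partial_comp_nested:
  assumes V: "vector_space scale" and \<rho>: "\<rho> \<in> cochains scale p" and \<sigma>: "\<sigma> \<in> cochains scale n"
    and \<tau>: "\<tau> \<in> cochains scale m"
    and i: "1 \<le> i" "i \<le> m" and j: "1 \<le> j" "j \<le> n" and p: "1 \<le> p"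
  shows "partial_comp scale (m + n - 1) (i + j - 1) p \<rho> (partial_comp scale m i n \<sigma> \<tau>) =
    partial_comp scale m i (n + p - 1) (partial_comp scale n j p \<rho> \<sigma>) \<tau>"
proof (rule ext, rule ext)
  fix r c
  have n: "m + n - 1 + p - 1 = m + (n + p - 1) - 1" using j p by simp
  show "partial_comp scale (m + n - 1) (i + j - 1) p \<rho> (partial_comp scale m i n \<sigma> \<tau>) r c =
    partial_comp scale m i (n + p - 1) (partial_comp scale n j p \<rho> \<sigma>) \<tau> r c"
  proof (cases "r \<in> {1..m + n - 1 + p - 1}")
    case True
    let ?r = "R0 (m + n - 1) (i + j - 1) p r"
    have ij: "1 \<le> i + j - 1" "i + j - 1 \<le> m + n - 1" using i j by auto
    have r: "1 \<le> ?r" "?r \<le> m + n - 1" using R0_range[OF ij] True by auto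
    have e: "R0 m i n ?r = R0 m i (n + p - 1) r" by (rule R0_nested[OF i(1) j p])
    have "partial_comp scale (m + n - 1) (i + j - 1) p \<rho> (partial_comp scale m i n \<sigma> \<tau>) r c =
        tensor_ids scale (m + n - 1) (i + j - 1) p (at_vec p \<rho> (R1 (m + n - 1) (i + j - 1) p r))
          (tensor_ids scale m i n (at_vec n \<sigma> (R1 m i n ?r)) (\<tau> (R0 m i n ?r) c))"
      using True r by (simp only: partial_comp_def if_True atLeastAtMost_iff simp_thms comp_apply)
    also have "\<dots> = tensor_ids scale m i (n + p - 1)
        (tensor_ids scale n j p (at_vec p \<rho> (R1 (m + n - 1) (i + j - 1) p r)) \<circ>
          at_vec n \<sigma> (R1 m i n ?r)) (\<tau> (R0 m i n ?r) c)"
      by (rule tensor_ids_nested[OF at_vec_R1_hom[OF V \<sigma> i(1)] at_vec_R1_hom[OF V \<rho> ij(1)] i j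
          hom_tensor_value[OF cochains_hom[OF \<tau> R0_range[OF i r]]]])
    also have "\<dots> = tensor_ids scale m i (n + p - 1)
        (at_vec (n + p - 1) (partial_comp scale n j p \<rho> \<sigma>) (R1 m i (n + p - 1) r)) (\<tau> (R0 m i (n + p - 1) r) c)"
      using True by (subst at_vec_partial_comp[OF V \<rho> \<sigma> i(1) j p]) (simp_all only: e atLeastAtMost_iff)
    also have "\<dots> = partial_comp scale m i (n + p - 1) (partial_comp scale n j p \<rho> \<sigma>) \<tau> r c"
      using True[unfolded n] by (simp add: partial_comp_def[of scale m])
    finally show ?thesis .
  next
    case False
    then show ?thesis
      using False[unfolded n] by (simp only: partial_comp_def if_False zero_fun_apply)
  qed
qed

lemma partial_comp_parallel:
  assumes V: "vector_space scale" and \<rho>: "\<rho> \<in> cochains scale n" and \<sigma>: "\<sigma> \<in> cochains scale p"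
    and \<tau>: "\<tau> \<in> cochains scale m"
    and i: "1 \<le> i" "i < k" "k \<le> m" and n: "1 \<le> n" and p: "1 \<le> p"
  shows "partial_comp scale (m + p - 1) i n \<rho> (partial_comp scale m k p \<sigma> \<tau>) =
    partial_comp scale (m + n - 1) (k + n - 1) p \<sigma> (partial_comp scale m i n \<rho> \<tau>)"
proof (rule ext, rule ext)
  fix r c
  have e: "m + n - 1 + p - 1 = m + p - 1 + n - 1" using n p by simp
  show "partial_comp scale (m + p - 1) i n \<rho> (partial_comp scale m k p \<sigma> \<tau>) r c =
    partial_comp scale (m + n - 1) (k + n - 1) p \<sigma> (partial_comp scale m i n \<rho> \<tau>) r c"
  proof (cases "r \<in> {1..m + p - 1 + n - 1}")
    case True
    let ?r = "R0 (m + p - 1) i n r" and ?r' = "R0 (m + n - 1) (k + n - 1) p r"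
    have k: "1 \<le> k" "1 \<le> k + n - 1" "k + n - 1 \<le> m + n - 1" "i \<le> m" "i \<le> m + p - 1" using i n by auto
    have r: "1 \<le> ?r" "?r \<le> m + p - 1" using R0_range[OF i(1) k(5)] True by auto
    have r': "1 \<le> ?r'" "?r' \<le> m + n - 1" using R0_range[OF k(2,3)] True e by auto
    have R: "R0 m k p ?r = R0 m i n ?r'" by (rule R0_parallel[OF i(1,2) n p])
    have block1: "i \<le> ?r' \<and> ?r' \<le> i + n - 1 \<longleftrightarrow> i \<le> r \<and> r \<le> i + n - 1"
      using i n p unfolding R0_def by (simp split: if_splits; linarith)
    have pos1: "?r' = r" if "i \<le> r \<and> r \<le> i + n - 1"
      using that i n p unfolding R0_def by auto
    have R1n: "at_vec n \<rho> (R1 (m + p - 1) i n r) = at_vec n \<rho> (R1 m i n ?r')"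
      unfolding at_vec_R1[OF i(1)] block1 using pos1 by simp
    have block2: "k \<le> ?r \<and> ?r \<le> k + p - 1 \<longleftrightarrow> k + n - 1 \<le> r \<and> r \<le> k + n - 1 + p - 1"
      using i n p unfolding R0_def
      by (cases "r \<le> i - 1"; cases "r \<le> i + n - 1"; simp; linarith)
    have pos2: "?r - k + 1 = r - (k + n - 1) + 1" if "k + n - 1 \<le> r \<and> r \<le> k + n - 1 + p - 1"
      using that i n p unfolding R0_def by (simp add: add.commute)
    have R1p: "at_vec p \<sigma> (R1 m k p ?r) = at_vec p \<sigma> (R1 (m + n - 1) (k + n - 1) p r)"
      unfolding at_vec_R1[OF k(1)] at_vec_R1[OF k(2)] block2 using pos2 by simp
    have "partial_comp scale (m + p - 1) i n \<rho> (partial_comp scale m k p \<sigma> \<tau>) r c =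
        tensor_ids scale (m + p - 1) i n (at_vec n \<rho> (R1 m i n ?r'))
          (tensor_ids scale m k p (at_vec p \<sigma> (R1 (m + n - 1) (k + n - 1) p r)) (\<tau> (R0 m i n ?r') c))"
      using True r
      by (simp only: partial_comp_def if_True atLeastAtMost_iff simp_thms comp_apply R R1n R1p)
    also have "\<dots> = tensor_ids scale (m + n - 1) (k + n - 1) p
        (at_vec p \<sigma> (R1 (m + n - 1) (k + n - 1) p r))
          (tensor_ids scale m i n (at_vec n \<rho> (R1 m i n ?r')) (\<tau> (R0 m i n ?r') c))"
      by (rule tensor_ids_parallel[OF at_vec_R1_hom[OF V \<sigma> k(2)] at_vec_R1_hom[OF V \<rho> i(1)] i
          hom_tensor_value[OF cochains_hom[OF \<tau> R0_range[OF i(1) k(4) r']]]])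
    also have "\<dots> = partial_comp scale (m + n - 1) (k + n - 1) p \<sigma> (partial_comp scale m i n \<rho> \<tau>) r c"
      using True[folded e] r'
      by (simp only: partial_comp_def if_True atLeastAtMost_iff simp_thms comp_apply)
    finally show ?thesis .
  next
    case False
    then show ?thesis
      using False[folded e] by (simp only: partial_comp_def if_False zero_fun_apply)
  qed
qed

lemma at_vec_add: "at_vec n (\<sigma> + \<tau>) x = at_vec n \<sigma> x + at_vec n \<tau> x"
  by (rule ext) (simp only: at_vec_def plus_fun_apply
      vector_space.vector_space_assms(1)[OF vector_space_tscale] sum.distrib)

lemma partial_comp_add_right:
  "partial_comp scale m i n \<sigma> (\<tau> + \<tau>') = partial_comp scale m i n \<sigma> \<tau> + partial_comp scale m i n \<sigma> \<tau>'"
proof (rule ext, rule ext)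
  fix r c
  show "partial_comp scale m i n \<sigma> (\<tau> + \<tau>') r c =
      (partial_comp scale m i n \<sigma> \<tau> + partial_comp scale m i n \<sigma> \<tau>') r c"
    using tensor_ids_linear[of scale m i n "at_vec n \<sigma> (R1 m i n r)"]
    by (simp add: partial_comp_def linear_iff')
qed

lemma partial_comp_add_left:
  assumes V: "vector_space scale" and \<sigma>: "\<sigma> \<in> cochains scale n" "\<sigma>' \<in> cochains scale n"
    and \<tau>: "\<tau> \<in> cochains scale m" and i: "1 \<le> i" "i \<le> m"
  shows "partial_comp scale m i n (\<sigma> + \<sigma>') \<tau> = partial_comp scale m i n \<sigma> \<tau> + partial_comp scale m i n \<sigma>' \<tau>"
proof (rule ext, rule ext)
  fix r c
  show "partial_comp scale m i n (\<sigma> + \<sigma>') \<tau> r c =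
      (partial_comp scale m i n \<sigma> \<tau> + partial_comp scale m i n \<sigma>' \<tau>) r c"
  proof (cases "r \<in> {1..m + n - 1}")
    case True
    then have "\<tau> (R0 m i n r) c \<in> tensor_power scale m"
      using hom_tensor_value[OF cochains_hom[OF \<tau> R0_range[OF i]]] by simp
    from tensor_ids_add_hom[OF at_vec_R1_hom[OF V \<sigma>(1) i(1)] at_vec_R1_hom[OF V \<sigma>(2) i(1)] i this]
    show ?thesis using True by (simp only: partial_comp_def if_True comp_apply plus_fun_apply at_vec_add)
  next
    case False
    then show ?thesis by (simp only: partial_comp_def if_False plus_fun_apply zero_fun_apply add_0)
  qed
qed

lemma cochains_zero: "vector_space scale \<Longrightarrow> 0 \<in> cochains scale n"
  by (auto simp: cochains_def hom_tensor_0)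

lemma cochains_add:
  "\<lbrakk>\<sigma> \<in> cochains scale n; \<tau> \<in> cochains scale n\<rbrakk> \<Longrightarrow> \<sigma> + \<tau> \<in> cochains scale n"
  by (simp add: cochains_def hom_tensor_add)

lemma cochains_uminus: "\<sigma> \<in> cochains scale n \<Longrightarrow> - \<sigma> \<in> cochains scale n"
  by (simp add: cochains_def hom_tensor_uminus)

lemma cochains_diff:
  "\<lbrakk>\<sigma> \<in> cochains scale n; \<tau> \<in> cochains scale n\<rbrakk> \<Longrightarrow> \<sigma> - \<tau> \<in> cochains scale n"
  using cochains_add[OF _ cochains_uminus] by fastforce

lemma cochains_sum:
  assumes "vector_space scale" "\<And>x. x \<in> X \<Longrightarrow> f x \<in> cochains scale n"
  shows "(\<Sum>x\<in>X. f x) \<in> cochains scale n"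
  using assms(2)
  by (induction X rule: infinite_finite_induct) (simp_all add: cochains_zero[OF assms(1)] cochains_add)

section \<open>The circle product and the Bianchi identity\<close>

text \<open>The product whose square is the defect of the dendriform identities, as the associator is
  for a multiplication. Its symmetrisation \<open>\<sigma> \<bullet> \<tau> + \<tau> \<bullet> \<sigma>\<close> is,
  up to sign, the Gerstenhaber bracket of 2-cochains.\<close>

definition circle_prod where
  "circle_prod scale \<sigma> \<tau> = partial_comp scale 2 2 2 \<sigma> \<tau> - partial_comp scale 2 1 2 \<sigma> \<tau>"

text \<open>The formula of the differential in degree 3 with an arbitrary 2-cochain \<open>\<rho>\<close> in place of
  the structure \<open>(\<Delta>\<^sub>\<prec>, \<Delta>\<^sub>\<succ>)\<close>, so that it can be evaluated along each coefficient of a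
  deformation.\<close>

definition coboundary_along where
  "coboundary_along scale \<rho> \<theta> = partial_comp scale 2 2 3 \<theta> \<rho> - partial_comp scale 3 1 2 \<rho> \<theta>
     + partial_comp scale 3 2 2 \<rho> \<theta> - partial_comp scale 3 3 2 \<rho> \<theta> + partial_comp scale 2 1 3 \<theta> \<rho>"

lemma tscale_minus_one: "tscale (- 1) t = - t"
  by (simp add: tscale_def fun_eq_iff)

lemma at_vec_costructure_R1:
  "1 \<le> i \<Longrightarrow> at_vec 2 (costructure l r) (R1 m i 2 s) =
    (if s = i then l else if s = i + 1 then r else l + r)"
proof -
  have "{1..2::nat} = {1,2}" by auto
  then show "1 \<le> i \<Longrightarrow> ?thesis" by (auto simp: at_vec_R1 costructure_def)
qed

lemma costructure_cochain:
  assumes "l \<in> hom_tensor scale 2" "r \<in> hom_tensor scale 2"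
  shows "costructure l r \<in> cochains scale 2"
  using assms by (auto simp: cochains_def costructure_def)

lemma coboundary_map_2:
  "coboundary_map scale Dl Dr 2 \<sigma> =
    circle_prod scale \<sigma> (costructure Dl Dr) + circle_prod scale (costructure Dl Dr) \<sigma>"
proof (rule ext, rule ext)
  fix r c
  have "{1..2::nat} = {1,2}" by auto
  then show "coboundary_map scale Dl Dr 2 \<sigma> r c =
      (circle_prod scale \<sigma> (costructure Dl Dr) + circle_prod scale (costructure Dl Dr) \<sigma>) r c"
    by (simp add: coboundary_map_def circle_prod_def partial_comp_def tscale_minus_one
        vector_space.vector_space_assms(4)[OF vector_space_tscale])
qed

lemma coboundary_map_3: "coboundary_map scale Dl Dr 3 \<theta> = coboundary_along scale (costructure Dl Dr) \<theta>"
proof (rule ext, rule ext)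
  fix r c
  have "{1..3::nat} = {1,2,3}" by auto
  then show "coboundary_map scale Dl Dr 3 \<theta> r c = coboundary_along scale (costructure Dl Dr) \<theta> r c"
    by (simp add: coboundary_map_def coboundary_along_def partial_comp_def tscale_minus_one
        vector_space.vector_space_assms(4)[OF vector_space_tscale])
qed

context
  fixes scale :: "'k::field_char_0 \<Rightarrow> 'c::ab_group_add \<Rightarrow> 'c"
  assumes V: "vector_space scale"
begin

abbreviation "tree i \<rho> j \<sigma> \<tau> \<equiv> partial_comp scale 3 i 2 \<rho> (partial_comp scale 2 j 2 \<sigma> \<tau>)"

lemma partial_comp_diff_right:
  "partial_comp scale m i n \<sigma> (\<tau> - \<tau>') = partial_comp scale m i n \<sigma> \<tau> - partial_comp scale m i n \<sigma> \<tau>'"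
  using partial_comp_add_right[of scale m i n \<sigma> "\<tau> - \<tau>'" \<tau>'] by (simp only: diff_add_cancel eq_diff_eq)

lemma partial_comp_diff_left:
  assumes "\<sigma> \<in> cochains scale n" "\<sigma>' \<in> cochains scale n" "\<tau> \<in> cochains scale m" "1 \<le> i" "i \<le> m"
  shows "partial_comp scale m i n (\<sigma> - \<sigma>') \<tau> = partial_comp scale m i n \<sigma> \<tau> - partial_comp scale m i n \<sigma>' \<tau>"
  using partial_comp_add_left[OF V cochains_diff[OF assms(1,2)] assms(2-5)]
  by (simp only: diff_add_cancel eq_diff_eq)

lemma circle_prod_cochain:
  assumes "\<sigma> \<in> cochains scale 2" "\<tau> \<in> cochains scale 2"
  shows "circle_prod scale \<sigma> \<tau> \<in> cochains scale 3"
  unfolding circle_prod_def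
  using partial_comp_cochain[OF V assms, of 1] partial_comp_cochain[OF V assms, of 2]
  by (simp add: cochains_diff)

lemma circle_prod_add_right:
  "circle_prod scale \<sigma> (\<tau> + \<tau>') = circle_prod scale \<sigma> \<tau> + circle_prod scale \<sigma> \<tau>'"
  unfolding circle_prod_def partial_comp_add_right by (simp only: algebra_simps)

lemma circle_prod_add_left:
  assumes "\<sigma> \<in> cochains scale 2" "\<sigma>' \<in> cochains scale 2" "\<tau> \<in> cochains scale 2"
  shows "circle_prod scale (\<sigma> + \<sigma>') \<tau> = circle_prod scale \<sigma> \<tau> + circle_prod scale \<sigma>' \<tau>"
proof -
  have "partial_comp scale 2 i 2 (\<sigma> + \<sigma>') \<tau> = partial_comp scale 2 i 2 \<sigma> \<tau> + partial_comp scale 2 i 2 \<sigma>' \<tau>"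
    if "i \<in> {1, 2}" for i
    by (rule partial_comp_add_left[OF V assms]) (use that in auto)
  then show ?thesis unfolding circle_prod_def by (simp only: insert_iff simp_thms algebra_simps)
qed

lemma circle_prod_zero_right: "circle_prod scale \<sigma> 0 = 0"
  using circle_prod_add_right[of \<sigma> 0 0] by simp

lemma circle_prod_zero_left: "\<tau> \<in> cochains scale 2 \<Longrightarrow> circle_prod scale 0 \<tau> = 0"
  using circle_prod_add_left[OF cochains_zero[OF V] cochains_zero[OF V], of \<tau>] by simp

lemma circle_prod_uminus_right: "circle_prod scale \<sigma> (- \<tau>) = - circle_prod scale \<sigma> \<tau>"
  using circle_prod_add_right[of \<sigma> \<tau> "- \<tau>"]
  by (simp only: right_minus circle_prod_zero_right) (metis minus_unique)

lemma circle_prod_uminus_left: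
  assumes "\<sigma> \<in> cochains scale 2" "\<tau> \<in> cochains scale 2"
  shows "circle_prod scale (- \<sigma>) \<tau> = - circle_prod scale \<sigma> \<tau>"
  using circle_prod_add_left[OF assms(1) cochains_uminus[OF assms(1)] assms(2)]
  by (simp only: right_minus circle_prod_zero_left[OF assms(2)]) (metis minus_unique)

text \<open>The ten threefold compositions in \<open>d\<^sub>\<rho> (\<sigma> \<bullet> \<tau>)\<close>, each paired with its partner of opposite
  sign. In the first four pairs, associativity of nested compositions has brought
  \<open>(\<sigma> \<bullet> \<tau>) \<circ>\<^sub>i \<rho>\<close> into the shape of the other terms, and the partners differ by a cyclic
  permutation of \<open>\<rho>, \<sigma>, \<tau>\<close>. In the last pair \<open>\<rho>\<close> and \<open>\<sigma>\<close> act on different tensor factors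
  and the partners differ by exchanging them.\<close>

lemma coboundary_along_circle_prod:
  assumes \<rho>: "\<rho> \<in> cochains scale 2" and \<sigma>: "\<sigma> \<in> cochains scale 2" and \<tau>: "\<tau> \<in> cochains scale 2"
  shows "coboundary_along scale \<rho> (circle_prod scale \<sigma> \<tau>) =
      (tree 3 \<sigma> 2 \<tau> \<rho> - tree 3 \<rho> 2 \<sigma> \<tau>) - (tree 2 \<sigma> 2 \<tau> \<rho> - tree 2 \<rho> 2 \<sigma> \<tau>)
    + (tree 2 \<sigma> 1 \<tau> \<rho> - tree 2 \<rho> 1 \<sigma> \<tau>) - (tree 1 \<sigma> 1 \<tau> \<rho> - tree 1 \<rho> 1 \<sigma> \<tau>)
    + (tree 3 \<rho> 1 \<sigma> \<tau> - tree 3 \<sigma> 1 \<rho> \<tau>)"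
proof -
  have c: "partial_comp scale 2 i 2 \<sigma> \<tau> \<in> cochains scale 3" if "1 \<le> i" "i \<le> 2" for i
    using partial_comp_cochain[OF V \<sigma> \<tau> that] by simp
  have nested: "partial_comp scale 2 i 3 (partial_comp scale 2 j 2 \<sigma> \<tau>) \<rho> = tree (i + j - 1) \<sigma> j' \<tau> \<rho>"
    if "1 \<le> i" "i \<le> 2" "1 \<le> j" "j \<le> 2" "j' = i" for i j j'
    using partial_comp_nested[OF V \<sigma> \<tau> \<rho> that(1-4)] that(5) by simp
  have left: "partial_comp scale 2 i 3 (circle_prod scale \<sigma> \<tau>) \<rho> = tree k \<sigma> i \<tau> \<rho> - tree i \<sigma> i \<tau> \<rho>"
    if i: "1 \<le> i" "i \<le> 2" and k: "k = i + 1" for i k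
    unfolding circle_prod_def
    using i k partial_comp_diff_left[OF c[of 2] c[of 1] \<rho> i] nested[OF i, of 2 i] nested[OF i, of 1 i] by simp
  have left1: "partial_comp scale 2 1 3 (circle_prod scale \<sigma> \<tau>) \<rho> = tree 2 \<sigma> 1 \<tau> \<rho> - tree 1 \<sigma> 1 \<tau> \<rho>"
    and left2: "partial_comp scale 2 2 3 (circle_prod scale \<sigma> \<tau>) \<rho> = tree 3 \<sigma> 2 \<tau> \<rho> - tree 2 \<sigma> 2 \<tau> \<rho>"
    using left[of 1 2] left[of 2 3] by simp_all
  have right: "partial_comp scale 3 i 2 \<rho> (circle_prod scale \<sigma> \<tau>) = tree i \<rho> 2 \<sigma> \<tau> - tree i \<rho> 1 \<sigma> \<tau>" for i
    unfolding circle_prod_def by (rule partial_comp_diff_right)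
  have parallel: "tree 1 \<rho> 2 \<sigma> \<tau> = tree 3 \<sigma> 1 \<rho> \<tau>"
    using partial_comp_parallel[OF V \<rho> \<sigma> \<tau>, of 1 2] by simp
  show ?thesis
    unfolding coboundary_along_def right left1 left2 parallel
    by (simp only: algebra_simps)
qed

end

lemma finite_pairs: "finite {(i, j). i + j = (N::nat)}"
  by (rule finite_subset[of _ "{..N} \<times> {..N}"]) auto

lemma sum_triples_rotate:
  fixes f :: "nat \<Rightarrow> nat \<Rightarrow> nat \<Rightarrow> 'a::comm_monoid_add"
  shows "(\<Sum>(i, j, k)\<in>{(i, j, k). i + j + k = N}. f j k i) = (\<Sum>(i, j, k)\<in>{(i, j, k). i + j + k = N}. f i j k)"
  by (rule sum.reindex_bij_witness[of _ "\<lambda>(i, j, k). (k, i, j)" "\<lambda>(i, j, k). (j, k, i)"]) auto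

lemma sum_triples_swap:
  fixes f :: "nat \<Rightarrow> nat \<Rightarrow> nat \<Rightarrow> 'a::comm_monoid_add"
  shows "(\<Sum>(i, j, k)\<in>{(i, j, k). i + j + k = N}. f j i k) = (\<Sum>(i, j, k)\<in>{(i, j, k). i + j + k = N}. f i j k)"
  by (rule sum.reindex_bij_witness[of _ "\<lambda>(i, j, k). (j, i, k)" "\<lambda>(i, j, k). (j, i, k)"]) auto

lemma sum_pairs_nested:
  fixes f :: "nat \<Rightarrow> nat \<Rightarrow> nat \<Rightarrow> 'a::comm_monoid_add"
  shows "(\<Sum>(i, l)\<in>{(i, l). i + l = N}. \<Sum>(j, k)\<in>{(j, k). j + k = l}. f i j k) =
    (\<Sum>(i, j, k)\<in>{(i, j, k). i + j + k = N}. f i j k)"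
proof -
  have "(\<Sum>(i, l)\<in>{(i, l). i + l = N}. \<Sum>(j, k)\<in>{(j, k). j + k = l}. f i j k) =
      (\<Sum>x\<in>{(i, l). i + l = N}. \<Sum>y\<in>{(j, k). j + k = snd x}. f (fst x) (fst y) (snd y))"
    by (simp add: case_prod_unfold)
  also have "\<dots> = (\<Sum>(x, y)\<in>Sigma {(i, l). i + l = N} (\<lambda>x. {(j, k). j + k = snd x}). f (fst x) (fst y) (snd y))"
    by (rule sum.Sigma) (simp_all add: finite_pairs)
  also have "\<dots> = (\<Sum>(i, j, k)\<in>{(i, j, k). i + j + k = N}. f i j k)"
    by (rule sum.reindex_bij_witness[of _ "\<lambda>(i, j, k). ((i, j + k), (j, k))" "\<lambda>((i, l), (j, k)). (i, j, k)"]) auto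
  finally show ?thesis .
qed

lemma additive_sum:
  fixes g :: "'a::ab_group_add \<Rightarrow> 'b::ab_group_add"
  assumes add: "\<And>x y. \<lbrakk>x \<in> S; y \<in> S\<rbrakk> \<Longrightarrow> g (x + y) = g x + g y"
    and S: "0 \<in> S" "\<And>x y. \<lbrakk>x \<in> S; y \<in> S\<rbrakk> \<Longrightarrow> x + y \<in> S" and f: "\<And>i. i \<in> X \<Longrightarrow> f i \<in> S"
  shows "g (\<Sum>i\<in>X. f i) = (\<Sum>i\<in>X. g (f i))"
proof -
  have 0: "g 0 = 0" using add[OF S(1) S(1)] by simp
  have "(\<Sum>i\<in>X. f i) \<in> S \<and> g (\<Sum>i\<in>X. f i) = (\<Sum>i\<in>X. g (f i))"
    using f by (induction X rule: infinite_finite_induct) (simp_all add: 0 S add)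
  then show ?thesis ..
qed

lemma coboundary_along_add:
  assumes V: "vector_space scale" and \<rho>: "\<rho> \<in> cochains scale 2"
    and \<theta>: "\<theta> \<in> cochains scale 3" "\<theta>' \<in> cochains scale 3"
  shows "coboundary_along scale \<rho> (\<theta> + \<theta>') = coboundary_along scale \<rho> \<theta> + coboundary_along scale \<rho> \<theta>'"
  using partial_comp_add_left[OF V \<theta> \<rho>, of 1] partial_comp_add_left[OF V \<theta> \<rho>, of 2]
  by (simp add: coboundary_along_def partial_comp_add_right algebra_simps)

lemma Bianchi_identity:
  fixes scale :: "'k::field_char_0 \<Rightarrow> 'c::ab_group_add \<Rightarrow> 'c"
    and p :: "nat \<Rightarrow> nat \<Rightarrow> 'c \<Rightarrow> ('c, 'k) tensor"
  assumes V: "vector_space scale" and p: "\<And>i. p i \<in> cochains scale 2"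
  shows "(\<Sum>(i, l)\<in>{(i, l). i + l = N}.
      coboundary_along scale (p i) (\<Sum>(j, k)\<in>{(j, k). j + k = l}. circle_prod scale (p j) (p k))) = 0"
proof -
  let ?T = "{(i, j, k). i + j + k = N}"
  note M = circle_prod_cochain[OF V p p]
  let ?t = "\<lambda>a b i j k. partial_comp scale 3 a 2 (p i) (partial_comp scale 2 b 2 (p j) (p k))"
  have distribute: "coboundary_along scale (p i) (\<Sum>(j, k)\<in>{(j, k). j + k = l}. circle_prod scale (p j) (p k)) =
      (\<Sum>(j, k)\<in>{(j, k). j + k = l}. coboundary_along scale (p i) (circle_prod scale (p j) (p k)))" for i l
    unfolding case_prod_unfold
    by (rule additive_sum[where g = "coboundary_along scale (p i)" and S = "cochains scale 3"
          and f = "\<lambda>x. circle_prod scale (p (fst x)) (p (snd x))" for i,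
          OF coboundary_along_add[OF V p] cochains_zero[OF V] cochains_add M])
  have rot: "(\<Sum>(i, j, k)\<in>?T. ?t a b j k i - ?t a b i j k) = 0" for a b
    using sum_triples_rotate[of "?t a b" N] by (simp only: case_prod_unfold sum_subtractf) simp
  have swap: "(\<Sum>(i, j, k)\<in>?T. ?t 3 1 i j k - ?t 3 1 j i k) = 0"
    using sum_triples_swap[of "?t 3 1" N] by (simp only: case_prod_unfold sum_subtractf) simp
  have "(\<Sum>(i, j, k)\<in>?T. coboundary_along scale (p i) (circle_prod scale (p j) (p k))) =
      (\<Sum>(i, j, k)\<in>?T. ?t 3 2 j k i - ?t 3 2 i j k) - (\<Sum>(i, j, k)\<in>?T. ?t 2 2 j k i - ?t 2 2 i j k)
    + (\<Sum>(i, j, k)\<in>?T. ?t 2 1 j k i - ?t 2 1 i j k) - (\<Sum>(i, j, k)\<in>?T. ?t 1 1 j k i - ?t 1 1 i j k)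
    + (\<Sum>(i, j, k)\<in>?T. ?t 3 1 i j k - ?t 3 1 j i k)"
    unfolding coboundary_along_circle_prod[OF V p p p] case_prod_unfold
    by (simp only: sum.distrib sum_subtractf)
  also have "\<dots> = 0" unfolding rot swap by simp
  finally show ?thesis unfolding distribute sum_pairs_nested .
qed

section \<open>Extending deformations\<close>

lemma circle_prod_costructure:
  fixes l r l' r' :: "'c::ab_group_add \<Rightarrow> ('c, 'k::field_char_0) tensor"
  shows "circle_prod scale (costructure l r) (costructure l' r') 1 =
      (tensor_ids scale 2 2 2 (l + r) \<circ> l') - (tensor_ids scale 2 1 2 l \<circ> l')"
    and "circle_prod scale (costructure l r) (costructure l' r') 2 =
      (tensor_ids scale 2 2 2 l \<circ> r') - (tensor_ids scale 2 1 2 r \<circ> l')"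
    and "circle_prod scale (costructure l r) (costructure l' r') 3 =
      (tensor_ids scale 2 2 2 r \<circ> r') - (tensor_ids scale 2 1 2 (l + r) \<circ> r')"
    and "s \<notin> {1, 2, 3} \<Longrightarrow> circle_prod scale (costructure l r) (costructure l' r') s = 0"
proof -
  have *: "partial_comp scale 2 i 2 (costructure l r) (costructure l' r') s = (if s \<in> {1, 2, 3}
      then tensor_ids scale 2 i 2 (if s = i then l else if s = i + 1 then r else l + r) \<circ>
        (if s + i \<le> 3 then l' else r') else 0)" if i: "i \<in> {1, 2}" for i s
  proof -
    have R0: "s \<in> {1, 2, 3} \<Longrightarrow> costructure l' r' (R0 2 i 2 s) = (if s + i \<le> 3 then l' else r')"
      using i by (auto simp: costructure_def R0_def)
    have i1: "1 \<le> i" using i by auto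
    have range: "s \<in> {1..2 + 2 - 1} \<longleftrightarrow> s \<in> {1, 2, 3}" by simp arith
    show ?thesis
      unfolding partial_comp_def range by (cases "s \<in> {1, 2, 3}")
        (simp_all only: if_True if_False R0 at_vec_costructure_R1[OF i1])
  qed
  have diff: "circle_prod scale \<sigma> \<tau> s = partial_comp scale 2 2 2 \<sigma> \<tau> s - partial_comp scale 2 1 2 \<sigma> \<tau> s"
    for \<sigma> \<tau> s by (simp only: circle_prod_def minus_apply)
  show "circle_prod scale (costructure l r) (costructure l' r') 1 =
      (tensor_ids scale 2 2 2 (l + r) \<circ> l') - (tensor_ids scale 2 1 2 l \<circ> l')"
    "circle_prod scale (costructure l r) (costructure l' r') 2 =
      (tensor_ids scale 2 2 2 l \<circ> r') - (tensor_ids scale 2 1 2 r \<circ> l')"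
    "circle_prod scale (costructure l r) (costructure l' r') 3 =
      (tensor_ids scale 2 2 2 r \<circ> r') - (tensor_ids scale 2 1 2 (l + r) \<circ> r')"
    "s \<notin> {1, 2, 3} \<Longrightarrow> circle_prod scale (costructure l r) (costructure l' r') s = 0"
    unfolding diff by (simp_all add: * del: minus_apply)
qed

lemma deformation_iff_circle_prod:
  "deformation scale Dl Dr n L R \<longleftrightarrow>
    (\<forall>i\<le>n. L i \<in> hom_tensor scale 2 \<and> R i \<in> hom_tensor scale 2) \<and> L 0 = Dl \<and> R 0 = Dr \<and>
    (\<forall>k\<le>n. (\<Sum>(i, j)\<in>{(i, j). i + j = k}.
      circle_prod scale (costructure (L i) (R i)) (costructure (L j) (R j))) = 0)"
proof -
  let ?M = "\<lambda>i j. circle_prod scale (costructure (L i) (R i)) (costructure (L j) (R j))"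
  have "((\<Sum>(i, j)\<in>P. ?M i j) = 0) \<longleftrightarrow>
      (\<Sum>(i, j)\<in>P. tensor_ids scale 2 1 2 (L i) \<circ> L j) =
      (\<Sum>(i, j)\<in>P. tensor_ids scale 2 2 2 (L i + R i) \<circ> L j) \<and>
      (\<Sum>(i, j)\<in>P. tensor_ids scale 2 1 2 (R i) \<circ> L j) =
      (\<Sum>(i, j)\<in>P. tensor_ids scale 2 2 2 (L i) \<circ> R j) \<and>
      (\<Sum>(i, j)\<in>P. tensor_ids scale 2 1 2 (L i + R i) \<circ> R j) =
      (\<Sum>(i, j)\<in>P. tensor_ids scale 2 2 2 (R i) \<circ> R j)" (is "?l \<longleftrightarrow> ?r1 \<and> ?r2 \<and> ?r3") for P
  proof -
    have "?l \<longleftrightarrow> (\<forall>s. (\<Sum>(i, j)\<in>P. ?M i j) s = 0)" by (simp only: fun_eq_iff[of _ 0] zero_fun_apply)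
    also have "\<dots> \<longleftrightarrow> (\<forall>s. (\<Sum>x\<in>P. ?M (fst x) (snd x) s) = 0)"
      by (simp only: sum_fun_apply case_prod_unfold)
    also have "\<dots> \<longleftrightarrow> (\<forall>s\<in>{1, 2, 3}. (\<Sum>x\<in>P. ?M (fst x) (snd x) s) = 0)"
    proof (intro iffI allI ballI)
      fix s assume zero: "\<forall>s\<in>{1, 2, 3}. (\<Sum>x\<in>P. ?M (fst x) (snd x) s) = 0"
      show "(\<Sum>x\<in>P. ?M (fst x) (snd x) s) = 0"
      proof (cases "s \<in> {1, 2, 3}")
        case True
        then show ?thesis by (rule bspec[OF zero])
      next
        case False
        then show ?thesis by (simp only: circle_prod_costructure(4) not_False_eq_True sum.neutral_const)
      qed
    qed (erule spec)
    also have "\<dots> \<longleftrightarrow> ?r1 \<and> ?r2 \<and> ?r3"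
      unfolding case_prod_unfold
      by (simp only: ball_simps circle_prod_costructure sum_subtractf right_minus_eq simp_thms)
        (intro conj_cong eq_commute)
    finally show ?thesis .
  qed
  then show ?thesis unfolding deformation_def by simp
qed

lemma costructure_components:
  assumes "\<sigma> \<in> cochains scale 2"
  shows "costructure (\<sigma> 1) (\<sigma> 2) = \<sigma>"
proof
  fix s :: nat
  show "costructure (\<sigma> 1) (\<sigma> 2) s = \<sigma> s"
    using assms by (cases "s = 1 \<or> s = 2") (auto simp: costructure_def cochains_def)
qed

text \<open>In the Bianchi identity of total degree \<open>N\<close> only the term of \<open>\<Theta> N\<close> survives if all lower
  coefficients \<open>\<Theta> k\<close> vanish.\<close>

lemma obstruction_closed:
  fixes scale :: "'k::field_char_0 \<Rightarrow> 'c::ab_group_add \<Rightarrow> 'c"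
    and p :: "nat \<Rightarrow> nat \<Rightarrow> 'c \<Rightarrow> ('c, 'k) tensor"
  assumes V: "vector_space scale" and p: "\<And>i. p i \<in> cochains scale 2"
    and lower: "\<And>k. k < N \<Longrightarrow> (\<Sum>(i, j)\<in>{(i, j). i + j = k}. circle_prod scale (p i) (p j)) = 0"
  defines "\<Theta> \<equiv> \<lambda>k. \<Sum>(i, j)\<in>{(i, j). i + j = k}. circle_prod scale (p i) (p j)"
  shows "\<Theta> N \<in> cochains scale 3" and "coboundary_along scale (p 0) (\<Theta> N) = 0"
proof -
  show "\<Theta> N \<in> cochains scale 3"
    unfolding \<Theta>_def case_prod_unfold by (rule cochains_sum[OF V circle_prod_cochain[OF V p p]])
  have cov0: "coboundary_along scale (p i) 0 = 0" for i
    using coboundary_along_add[OF V p cochains_zero[OF V] cochains_zero[OF V], of i] by simp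
  have zero: "\<Theta> k = 0" if "k < N" for k unfolding \<Theta>_def by (rule lower[OF that])
  have "(\<Sum>(i, l)\<in>{(i, l). i + l = N}. coboundary_along scale (p i) (\<Theta> l)) =
      (\<Sum>(i, l)\<in>{(0, N)}. coboundary_along scale (p i) (\<Theta> l))"
    by (rule sum.mono_neutral_right[OF finite_pairs]) (auto simp: zero cov0)
  then have "coboundary_along scale (p 0) (\<Theta> N) = (\<Sum>(i, l)\<in>{(i, l). i + l = N}. coboundary_along scale (p i) (\<Theta> l))"
    by simp
  also have "\<dots> = 0" unfolding \<Theta>_def by (rule Bianchi_identity[OF V p])
  finally show "coboundary_along scale (p 0) (\<Theta> N) = 0" .
qed

lemma coboundaries_3: "coboundaries scale Dl Dr 3 = coboundary_map scale Dl Dr 2 ` cochains scale 2"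
  by (simp add: coboundaries_def)

text \<open>\<open>H\<^sup>n\<close> is a set of cosets, so its triviality says that the coset of \<open>\<theta>\<close> is the set of
  coboundaries itself; it contains \<open>\<theta>\<close> as soon as 0 is a coboundary.\<close>

lemma cocycle_is_coboundary:
  assumes "cohomology scale Dl Dr n = {coboundaries scale Dl Dr n}"
    and "\<theta> \<in> cocycles scale Dl Dr n" and zero: "0 \<in> coboundaries scale Dl Dr n"
  shows "\<theta> \<in> coboundaries scale Dl Dr n"
proof -
  have "{\<theta> + \<beta> | \<beta>. \<beta> \<in> coboundaries scale Dl Dr n} \<in> cohomology scale Dl Dr n"
    unfolding cohomology_def using assms(2) by (rule imageI)
  then have "{\<theta> + \<beta> | \<beta>. \<beta> \<in> coboundaries scale Dl Dr n} = coboundaries scale Dl Dr n"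
    unfolding assms(1) by (rule singletonD)
  moreover have "\<theta> + 0 \<in> {\<theta> + \<beta> | \<beta>. \<beta> \<in> coboundaries scale Dl Dr n}"
    by (rule CollectI, rule exI[of _ 0], rule conjI[OF refl zero])
  ultimately show ?thesis by (simp only: add_0_right)
qed

theorem theorem4p9:
  fixes scale :: "'k::field_char_0 \<Rightarrow> 'c::ab_group_add \<Rightarrow> 'c"
    and Dl Dr :: "'c \<Rightarrow> ('c, 'k) tensor"
  assumes "dendriform_coalgebra scale Dl Dr"
    and "cohomology scale Dl Dr 3 = {coboundaries scale Dl Dr 3}"
  shows "\<forall>n L R. deformation scale Dl Dr n L R \<longrightarrow> extends_to_next_order scale Dl Dr n L R"
proof (intro allI impI)
  fix n L R
  assume def: "deformation scale Dl Dr n L R"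
  interpret dendriform_coalgebra scale Dl Dr by (rule assms(1))
  have V: "vector_space scale" by unfold_locales
  let ?\<pi> = "costructure Dl Dr"
  \<comment> \<open>The value \<open>p (n + 1) = 0\<close> makes \<open>\<Theta> (n + 1)\<close> the part of the next equation that is
    already determined by the given deformation.\<close>
  define p where "p i = (if i \<le> n then costructure (L i) (R i) else 0)" for i
  define \<Theta> where "\<Theta> k = (\<Sum>(i, j)\<in>{(i, j). i + j = k}. circle_prod scale (p i) (p j))" for k
  have \<pi>: "?\<pi> \<in> cochains scale 2" by (rule costructure_cochain[OF Dl_hom Dr_hom])
  have p0: "p 0 = ?\<pi>" using def by (simp add: p_def deformation_def)
  have pc: "p i \<in> cochains scale 2" for i
    using def by (auto simp: p_def deformation_def cochains_zero[OF V] intro: costructure_cochain)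
  have lower: "\<Theta> k = 0" if "k \<le> n" for k
  proof -
    have "\<Theta> k = (\<Sum>(i, j)\<in>{(i, j). i + j = k}.
        circle_prod scale (costructure (L i) (R i)) (costructure (L j) (R j)))"
      unfolding \<Theta>_def by (rule sum.cong) (use that in \<open>auto simp: p_def\<close>)
    then show ?thesis using def that unfolding deformation_iff_circle_prod by simp
  qed
  have obstruction: "\<Theta> (n + 1) \<in> cochains scale 3" "coboundary_along scale (p 0) (\<Theta> (n + 1)) = 0"
    using obstruction_closed[OF V pc lower[unfolded \<Theta>_def]] unfolding \<Theta>_def by simp_all
  then have "\<Theta> (n + 1) \<in> cocycles scale Dl Dr 3"
    by (simp only: cocycles_def mem_Collect_eq coboundary_map_3 p0 simp_thms)
  moreover have "0 \<in> coboundaries scale Dl Dr 3"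
    unfolding coboundaries_3
    by (rule rev_image_eqI[OF cochains_zero[OF V]])
       (simp only: coboundary_map_2 circle_prod_zero_left[OF V \<pi>] circle_prod_zero_right[OF V] add_0)
  ultimately have "\<Theta> (n + 1) \<in> coboundaries scale Dl Dr 3"
    by (rule cocycle_is_coboundary[OF assms(2)])
  then obtain \<sigma> where \<Theta>\<sigma>: "\<Theta> (n + 1) = coboundary_map scale Dl Dr 2 \<sigma>" and \<sigma>: "\<sigma> \<in> cochains scale 2"
    unfolding coboundaries_3 by (rule imageE)
  define \<tau> where "\<tau> = - \<sigma>"
  have \<tau>: "\<tau> \<in> cochains scale 2" unfolding \<tau>_def by (rule cochains_uminus[OF \<sigma>])
  have cancel: "\<Theta> (n + 1) + (circle_prod scale \<tau> ?\<pi> + circle_prod scale ?\<pi> \<tau>) = 0"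
    unfolding \<Theta>\<sigma> coboundary_map_2 \<tau>_def circle_prod_uminus_left[OF V \<sigma> \<pi>]
      circle_prod_uminus_right[OF V] by (simp only: minus_add_distrib[symmetric] right_minus)
  define L' R' where "L' = L(n + 1 := \<tau> 1)" and "R' = R(n + 1 := \<tau> 2)"
  define q where "q i = costructure (L' i) (R' i)" for i
  have q_low: "q i = p i" if "i \<le> n" for i using that by (simp add: q_def p_def L'_def R'_def)
  have q_top: "q (n + 1) = \<tau>"
    by (simp only: q_def L'_def R'_def fun_upd_same costructure_components[OF \<tau>])
  have "(\<Sum>(i, j)\<in>{(i, j). i + j = k}. circle_prod scale (q i) (q j)) = 0" if k: "k \<le> n + 1" for k
  proof (cases "k = n + 1")
    case False
    have "(\<Sum>(i, j)\<in>{(i, j). i + j = k}. circle_prod scale (q i) (q j)) = \<Theta> k"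
      unfolding \<Theta>_def by (rule sum.cong) (use k False in \<open>auto simp: q_low\<close>)
    then show ?thesis using k False lower by simp
  next
    case True
    \<comment> \<open>Replacing \<open>p (n + 1) = 0\<close> by \<open>\<tau>\<close> changes only the terms \<open>(n + 1, 0)\<close> and
      \<open>(0, n + 1)\<close>, and these changes add up to the coboundary of \<open>\<tau>\<close>.\<close>
    let ?new = "\<lambda>(i, j). if i = n + 1 then circle_prod scale \<tau> ?\<pi> else if j = n + 1 then circle_prod scale ?\<pi> \<tau> else 0"
    have ptop: "p (n + 1) = 0" by (simp add: p_def)
    have "(\<Sum>(i, j)\<in>{(i, j). i + j = n + 1}. circle_prod scale (q i) (q j)) =
        (\<Sum>x\<in>{(i, j). i + j = n + 1}. (case x of (i, j) \<Rightarrow> circle_prod scale (p i) (p j)) + ?new x)"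
    proof (rule sum.cong[OF refl])
      fix x assume "x \<in> {(i, j). i + j = n + 1}"
      then consider "x = (n + 1, 0)" | "x = (0, n + 1)" | i j where "x = (i, j)" "i \<le> n" "j \<le> n"
        by (cases x) fastforce
      then show "(case x of (i, j) \<Rightarrow> circle_prod scale (q i) (q j)) =
          (case x of (i, j) \<Rightarrow> circle_prod scale (p i) (p j)) + ?new x"
      proof cases
        case 1
        show ?thesis
          unfolding 1 case_prod_conv q_top q_low[OF le0] ptop p0 circle_prod_zero_left[OF V \<pi>]
          by (simp only: refl if_True add_0)
      next
        case 2
        have "0 = n + 1 \<longleftrightarrow> False" by simp
        then show ?thesis
          unfolding 2 case_prod_conv q_top q_low[OF le0] ptop p0 circle_prod_zero_right[OF V]
          by (simp only: refl if_True if_False add_0)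
      next
        case (3 i j)
        have "i = n + 1 \<longleftrightarrow> False" "j = n + 1 \<longleftrightarrow> False" using 3 by auto
        then show ?thesis
          unfolding 3(1) case_prod_conv q_low[OF 3(2)] q_low[OF 3(3)]
          by (simp only: if_False add_0_right)
      qed
    qed
    also have "\<dots> = \<Theta> (n + 1) + (\<Sum>x\<in>{(i, j). i + j = n + 1}. ?new x)"
      by (simp only: \<Theta>_def sum.distrib)
    also have "(\<Sum>x\<in>{(i, j). i + j = n + 1}. ?new x) = (\<Sum>x\<in>{(n + 1, 0), (0, n + 1)}. ?new x)"
      by (rule sum.mono_neutral_right[OF finite_pairs]) auto
    also have "\<dots> = circle_prod scale \<tau> ?\<pi> + circle_prod scale ?\<pi> \<tau>" by simp
    finally show ?thesis unfolding True cancel .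
  qed
  moreover have "L' i \<in> hom_tensor scale 2 \<and> R' i \<in> hom_tensor scale 2" if "i \<le> n + 1" for i
    using that def cochains_hom[OF \<tau>] by (auto simp: deformation_def L'_def R'_def le_Suc_eq)
  ultimately have "deformation scale Dl Dr (n + 1) L' R'"
    using def unfolding deformation_iff_circle_prod q_def by (auto simp: L'_def R'_def)
  then show "extends_to_next_order scale Dl Dr n L R"
    unfolding extends_to_next_order_def L'_def R'_def
    using cochains_hom[OF \<tau>, of 1] cochains_hom[OF \<tau>, of 2]
    by (intro exI[of _ "\<tau> 1"] exI[of _ "\<tau> 2"]) simp
qed

end
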